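(* Let $M$ be a realizable matroid of rank $n$ on the ground set $[d]$. Then $$nd-\sum_{l\in\mathcal{L}_M}(|l|-\mathrm{rank}(l))(n-\mathrm{rank}(l))\leq \dim(\Gamma_M).$$ That is, the naive dimension $\dim_{\mathrm{naive}}(\Gamma_M)$ is at most $\dim(\Gamma_M)$.
   Context: Subspaces: for a matroid $M$ of rank $n$ with closure operator $\mathrm{cl}$, consider the circuits of $M$ of size at most $n$, and call two such circuits $C_1,C_2$ equivalent if $\mathrm{cl}(C_1)=\mathrm{cl}(C_2)$. An equivalence class $l$ is a subspace; $\mathrm{rank}(l)$ is the rank of any circuit in $l$; a point $p$ belongs to $l$ if some circuit in $l$ contains $p$; $|l|$ is the number of points belonging to $l$. $\mathcal{L}_M$ is the set of subspaces. A realization of $M$ is a family $(\gamma_1,\ldots,\gamma_d)$ of vectors in $\mathbb{C}^n$ (a point of $\mathbb{C}^{nd}$) such that for every $S\subseteq[d]$, $\{\gamma_i:i\in S\}$ is linearly dependent iff $S$ is dependent in $M$; $\Gamma_M\subseteq\mathbb{C}^{nd}$ is the set of realizations (a quasi-affine variety), and $M$ is realizable if $\Gamma_M\neq\emptyset$. *)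

theory Defs
  imports
    "HOL-Analysis.Abstract_Topology"
    "HOL-Library.Extended_Real"
    "HOL-Library.FuncSet"
begin

section \<open>Matroids\<close>

locale matroid =
  fixes E :: "'a set" and indep :: "'a set \<Rightarrow> bool"
  assumes finite_ground: "finite E"
    and indep_subset_ground: "indep X \<Longrightarrow> X \<subseteq> E"
    and indep_empty: "indep {}"
    and indep_subset: "indep X \<Longrightarrow> Y \<subseteq> X \<Longrightarrow> indep Y"
    and indep_augment:
      "indep X \<Longrightarrow> indep Y \<Longrightarrow> card X < card Y \<Longrightarrow> \<exists>y\<in>Y - X. indep (insert y X)"
begin

definition rank_of :: "'a set \<Rightarrow> nat" where
  "rank_of X = Max {card Y | Y. Y \<subseteq> X \<and> indep Y}"

definition cl :: "'a set \<Rightarrow> 'a set" where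
  "cl X = {x \<in> E. rank_of (insert x X) = rank_of X}"

definition dependent :: "'a set \<Rightarrow> bool" where
  "dependent X \<longleftrightarrow> X \<subseteq> E \<and> \<not> indep X"

definition circuit :: "'a set \<Rightarrow> bool" where
  "circuit C \<longleftrightarrow> dependent C \<and> (\<forall>D. D \<subset> C \<longrightarrow> \<not> dependent D)"

definition small_circuits :: "'a set set" where
  "small_circuits = {C. circuit C \<and> card C \<le> rank_of E}"

definition circuit_equiv :: "('a set \<times> 'a set) set" where
  "circuit_equiv =
    {(C, D). C \<in> small_circuits \<and> D \<in> small_circuits \<and> cl C = cl D}"

definition subspaces :: "'a set set set" where
  "subspaces = small_circuits // circuit_equiv"

text \<open>All circuits in a subspace have the same rank, so the image below is a singleton.\<close>

definition subspace_rank :: "'a set set \<Rightarrow> nat" where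
  "subspace_rank l = the_elem (rank_of ` l)"

definition subspace_points :: "'a set set \<Rightarrow> 'a set" where
  "subspace_points l = {p. \<exists>C\<in>l. p \<in> C}"

end

section \<open>Zariski topology and dimension\<close>

definition affine_space :: "'i set \<Rightarrow> ('i \<Rightarrow> complex) set" where
  "affine_space I = I \<rightarrow>\<^sub>E UNIV"

inductive_set poly_functions :: "'i set \<Rightarrow> (('i \<Rightarrow> complex) \<Rightarrow> complex) set"
  for I :: "'i set" where
  const: "(\<lambda>x. c) \<in> poly_functions I"
| coord: "i \<in> I \<Longrightarrow> (\<lambda>x. x i) \<in> poly_functions I"
| add: "f \<in> poly_functions I \<Longrightarrow> g \<in> poly_functions I \<Longrightarrow> (\<lambda>x. f x + g x) \<in> poly_functions I"
| mult: "f \<in> poly_functions I \<Longrightarrow> g \<in> poly_functions I \<Longrightarrow> (\<lambda>x. f x * g x) \<in> poly_functions I"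

definition zero_set ::
    "'i set \<Rightarrow> (('i \<Rightarrow> complex) \<Rightarrow> complex) set \<Rightarrow> ('i \<Rightarrow> complex) set" where
  "zero_set I F = {x \<in> affine_space I. \<forall>f\<in>F. f x = 0}"

definition zariski_topology :: "'i set \<Rightarrow> ('i \<Rightarrow> complex) topology" where
  "zariski_topology I =
    topology (\<lambda>U. \<exists>F\<subseteq>poly_functions I. U = affine_space I - zero_set I F)"

lemma istopology_zariski:
  "istopology (\<lambda>U. \<exists>F\<subseteq>poly_functions I. U = affine_space I - zero_set I F)"
  unfolding istopology_def
proof (intro conjI allI impI)
  fix S T
  assume "\<exists>F\<subseteq>poly_functions I. S = affine_space I - zero_set I F"
    and "\<exists>F\<subseteq>poly_functions I. T = affine_space I - zero_set I F"
  then obtain F G where F: "F \<subseteq> poly_functions I" "S = affine_space I - zero_set I F"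
    and G: "G \<subseteq> poly_functions I" "T = affine_space I - zero_set I G"
    by blast
  let ?H = "{\<lambda>x. f x * g x | f g. f \<in> F \<and> g \<in> G}"
  have "?H \<subseteq> poly_functions I"
    using F(1) G(1) by (auto intro!: poly_functions.mult)
  moreover have "S \<inter> T = affine_space I - zero_set I ?H"
    unfolding F(2) G(2) zero_set_def by (auto; fastforce)
  ultimately show "\<exists>F\<subseteq>poly_functions I. S \<inter> T = affine_space I - zero_set I F"
    by blast
next
  fix K :: "('a \<Rightarrow> complex) set set"
  assume "\<forall>U\<in>K. \<exists>F\<subseteq>poly_functions I. U = affine_space I - zero_set I F"
  then obtain H where H: "\<And>U. U \<in> K \<Longrightarrow> H U \<subseteq> poly_functions I"
      "\<And>U. U \<in> K \<Longrightarrow> U = affine_space I - zero_set I (H U)"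
    by metis
  have "\<Union>K = (\<Union>U\<in>K. affine_space I - zero_set I (H U))"
    using H(2) by auto
  also have "\<dots> = affine_space I - zero_set I (\<Union>(H ` K))"
    by (auto simp: zero_set_def)
  finally have "\<Union>K = affine_space I - zero_set I (\<Union>(H ` K))" .
  moreover have "\<Union>(H ` K) \<subseteq> poly_functions I"
    using H(1) by blast
  ultimately show "\<exists>F\<subseteq>poly_functions I. \<Union>K = affine_space I - zero_set I F"
    by blast
qed

lemma openin_zariski:
  "openin (zariski_topology I) U \<longleftrightarrow>
    (\<exists>F\<subseteq>poly_functions I. U = affine_space I - zero_set I F)"
  by (simp add: zariski_topology_def istopology_zariski topology_inverse')

lemma topspace_zariski: "topspace (zariski_topology I) = affine_space I"
proof
  show "topspace (zariski_topology I) \<subseteq> affine_space I"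
    unfolding topspace_def openin_zariski by blast
  have "openin (zariski_topology I) (affine_space I)"
    unfolding openin_zariski
    by (rule exI[of _ "{\<lambda>x. 1}"]) (auto simp: zero_set_def intro: poly_functions.const)
  then show "affine_space I \<subseteq> topspace (zariski_topology I)"
    by (rule openin_subset)
qed

lemma closedin_zariski:
  "closedin (zariski_topology I) Z \<longleftrightarrow> (\<exists>F\<subseteq>poly_functions I. Z = zero_set I F)"
proof -
  have sub: "zero_set I F \<subseteq> affine_space I" for F :: "(('a \<Rightarrow> complex) \<Rightarrow> complex) set"
    by (auto simp: zero_set_def)
  show ?thesis
    unfolding closedin_def topspace_zariski openin_zariski
    using sub by (metis double_diff subset_refl)
qed

definition irreducible_in :: "'a topology \<Rightarrow> 'a set \<Rightarrow> bool" where
  "irreducible_in T Z \<longleftrightarrow> Z \<subseteq> topspace T \<and> Z \<noteq> {} \<and>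
    (\<forall>A B. closedin T A \<and> closedin T B \<and> Z \<subseteq> A \<union> B \<longrightarrow> Z \<subseteq> A \<or> Z \<subseteq> B)"

text \<open>The value is \<open>-\<infinity>\<close> for the empty space.\<close>

definition krull_dim :: "'a topology \<Rightarrow> ereal" where
  "krull_dim T = Sup {ereal (real k) | k. \<exists>Z :: nat \<Rightarrow> 'a set.
      (\<forall>i\<le>k. closedin T (Z i) \<and> irreducible_in T (Z i)) \<and> (\<forall>i<k. Z i \<subset> Z (Suc i))}"

definition zariski_dim :: "'i set \<Rightarrow> ('i \<Rightarrow> complex) set \<Rightarrow> ereal" where
  "zariski_dim I X = krull_dim (subtopology (zariski_topology I) X)"

section \<open>Realizations\<close>

text \<open>
  A family of vectors \<open>\<gamma>\<^sub>i\<close> in complex \<open>n\<close>-space, indexed by \<open>i \<in> E\<close>, is a point of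
  \<open>affine_space ({1..n} \<times> E)\<close>; \<open>\<gamma> (k, i)\<close> is the \<open>k\<close>-th coordinate of \<open>\<gamma>\<^sub>i\<close>.
  Dependence is that of the family, so that repeated vectors are dependent.
\<close>

definition lin_dep_family :: "nat \<Rightarrow> (nat \<times> 'a \<Rightarrow> complex) \<Rightarrow> 'a set \<Rightarrow> bool" where
  "lin_dep_family n \<gamma> S \<longleftrightarrow>
    (\<exists>c :: 'a \<Rightarrow> complex. (\<exists>i\<in>S. c i \<noteq> 0) \<and> (\<forall>k\<in>{1..n}. (\<Sum>i\<in>S. c i * \<gamma> (k, i)) = 0))"

context matroid
begin

definition realization_space :: "(nat \<times> 'a \<Rightarrow> complex) set" where
  "realization_space = {\<gamma> \<in> affine_space ({1..rank_of E} \<times> E).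
      \<forall>S\<subseteq>E. lin_dep_family (rank_of E) \<gamma> S \<longleftrightarrow> dependent S}"

definition realizable :: bool where
  "realizable \<longleftrightarrow> realization_space \<noteq> {}"

end

end

theory Submission
  imports Defs
    "HOL-Analysis.Continuum_Not_Denumerable"
    "HOL-Computational_Algebra.Fundamental_Theorem_Algebra"
    "HOL-Library.Function_Algebras"
    "Jordan_Normal_Form.Determinant"
begin

text \<open>
  Near a realization \<open>p\<close>, the realization space is cut out by as many equations as the naive
  dimension subtracts: for a subspace \<open>l\<close> of rank \<open>r\<close> choose a basis \<open>B\<close> of \<open>l\<close> and extend it to a basis
  \<open>T\<close> of the matroid. As long as all bases stay independent, a point \<open>q\<close> of \<open>l\<close> stays in the span of
  \<open>B\<close> iff the \<open>n - r\<close> determinants of \<open>T - b + q\<close> with \<open>b \<in> T - B\<close> vanish.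

  It remains to see that \<open>N\<close> equations lower the dimension at \<open>p\<close> by at most \<open>N\<close>. If there were no chain of
  irreducible closed sets through \<open>p\<close> of length \<open>m - N\<close>, fewer than \<open>m - N\<close> further generic equations would
  make \<open>p\<close> an isolated zero of fewer than \<open>m\<close> polynomials in \<open>m\<close> variables. The Nullstellensatz and a
  count of dimensions modulo powers of the maximal ideal of \<open>p\<close> exclude this.
\<close>

section \<open>Noetherian rings\<close>

text \<open>Dimension is defined by chains of closed sets, so a lower bound has to exhibit a chain;
  dimension theory of local rings is replaced by counting. Near \<open>p\<close> an inclusion
  suffices: a point where all basis determinants are nonzero (their product is \<open>g\<close>) and
  all exchange determinants vanish is a realization. Circuits with more than \<open>n\<close>
  elements impose no equation, since more than \<open>n\<close> vectors in \<open>n\<close>-space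
  are always dependent. A smaller circuit in a subspace with basis \<open>B\<close> has
  \<open>|B| + 1\<close> elements, hence becomes dependent as soon as its points stay in the span of
  \<open>B\<close>. Pairs of a point of \<open>l\<close> outside \<open>B\<close> and an element of
  \<open>T - B\<close> number \<open>(|l| - r)(n - r)\<close>, which is the term of the sum. No
  localization is formed at \<open>p\<close>: powers of \<open>g\<close> are carried along as
  denominators, and since \<open>g p\<close> is nonzero they do not affect orders of vanishing at
  \<open>p\<close>. If the naive dimension is negative, the bound holds because a point is a chain
  of length \<open>0\<close>.\<close>

inductive_set ideal_span :: "'a::comm_ring_1 set \<Rightarrow> 'a set \<Rightarrow> 'a set" for S F where
  zero: "0 \<in> ideal_span S F"
| add_mult: "a \<in> ideal_span S F \<Longrightarrow> r \<in> S \<Longrightarrow> f \<in> F \<Longrightarrow> a + r * f \<in> ideal_span S F"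

text \<open>Rings are sets inside a type because the polynomial functions form a subset of the ring
  of all functions under pointwise operations. Closure under differences yields zero and
  negatives.\<close>

definition subring_carrier :: "'a::comm_ring_1 set \<Rightarrow> bool" where
  "subring_carrier S \<longleftrightarrow> 1 \<in> S \<and> (\<forall>a\<in>S. \<forall>b\<in>S. a - b \<in> S \<and> a * b \<in> S)"

text \<open>The ascending chain condition in sequence form. It passes directly along ring
  homomorphisms and is what a descending chain of closed sets contradicts.\<close>

definition noetherian_carrier :: "'a::comm_ring_1 set \<Rightarrow> bool" where
  "noetherian_carrier S \<longleftrightarrow>
    (\<forall>a::nat \<Rightarrow> 'a. range a \<subseteq> S \<longrightarrow> (\<exists>N. a N \<in> ideal_span S (a ` {..<N})))"

lemma subring_carrierD:
  assumes "subring_carrier S"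
  shows "0 \<in> S" "1 \<in> S" "a \<in> S \<Longrightarrow> b \<in> S \<Longrightarrow> a - b \<in> S"
    "a \<in> S \<Longrightarrow> b \<in> S \<Longrightarrow> a + b \<in> S" "a \<in> S \<Longrightarrow> b \<in> S \<Longrightarrow> a * b \<in> S" "a \<in> S \<Longrightarrow> - a \<in> S"
proof -
  show *: "1 \<in> S" "\<And>a b. a \<in> S \<Longrightarrow> b \<in> S \<Longrightarrow> a - b \<in> S" "a \<in> S \<Longrightarrow> b \<in> S \<Longrightarrow> a * b \<in> S"
    using assms by (auto simp: subring_carrier_def)
  show z: "0 \<in> S" using *(2)[OF *(1) *(1)] by simp
  show neg: "- a \<in> S" if "a \<in> S" for a using *(2)[OF z that] by simp
  show "a + b \<in> S" if "a \<in> S" "b \<in> S" using *(2)[OF that(1) neg[OF that(2)]] by simp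
qed

lemma subring_carrier_sum:
  assumes "subring_carrier S" "\<And>x. x \<in> A \<Longrightarrow> f x \<in> S"
  shows "sum f A \<in> S"
  using assms(2) by (induction A rule: infinite_finite_induct) (auto intro: subring_carrierD[OF assms(1)])

lemma subring_carrier_prod:
  assumes "subring_carrier S" "\<And>x. x \<in> A \<Longrightarrow> f x \<in> S"
  shows "prod f A \<in> S"
  using assms(2) by (induction A rule: infinite_finite_induct) (auto intro: subring_carrierD[OF assms(1)])

lemma subring_carrier_power:
  assumes "subring_carrier S" "a \<in> S"
  shows "a ^ k \<in> S"
  by (induction k) (auto intro: subring_carrierD[OF assms(1)] assms(2))

lemma ideal_span_add: "b \<in> ideal_span S F \<Longrightarrow> a \<in> ideal_span S F \<Longrightarrow> a + b \<in> ideal_span S F"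
  by (induction b rule: ideal_span.induct) (auto simp: add.assoc[symmetric] intro: ideal_span.intros)

lemma ideal_span_mult:
  assumes "subring_carrier S" "r \<in> S"
  shows "a \<in> ideal_span S F \<Longrightarrow> r * a \<in> ideal_span S F"
  by (induction a rule: ideal_span.induct)
    (auto simp: distrib_left mult.assoc[symmetric]
      intro: ideal_span.intros subring_carrierD[OF assms(1)] assms(2))

lemma ideal_span_generator: "subring_carrier S \<Longrightarrow> f \<in> F \<Longrightarrow> f \<in> ideal_span S F"
  using ideal_span.add_mult[OF ideal_span.zero, of 1 S f F] by (simp add: subring_carrierD)

lemma ideal_span_diff:
  assumes "subring_carrier S" "a \<in> ideal_span S F" "b \<in> ideal_span S F"
  shows "a - b \<in> ideal_span S F"
proof -
  have "- 1 * b \<in> ideal_span S F"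
    by (rule ideal_span_mult[OF assms(1) _ assms(3)]) (simp add: subring_carrierD[OF assms(1)])
  from ideal_span_add[OF this assms(2)] show ?thesis by simp
qed

lemma ideal_span_sum:
  assumes "\<And>x. x \<in> A \<Longrightarrow> f x \<in> ideal_span S F"
  shows "sum f A \<in> ideal_span S F"
  using assms by (induction A rule: infinite_finite_induct) (auto intro: ideal_span_add ideal_span.zero)

lemma ideal_span_least:
  assumes "subring_carrier S" "F \<subseteq> ideal_span S G"
  shows "ideal_span S F \<subseteq> ideal_span S G"
proof
  fix a assume "a \<in> ideal_span S F"
  then show "a \<in> ideal_span S G"
    by induction (use assms in \<open>auto intro: ideal_span.zero ideal_span_add ideal_span_mult\<close>)
qed

lemma ideal_span_mono: "F \<subseteq> G \<Longrightarrow> ideal_span S F \<subseteq> ideal_span S G"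
proof
  fix a assume "F \<subseteq> G" "a \<in> ideal_span S F"
  from this(2,1) show "a \<in> ideal_span S G"
    by induction (auto intro: ideal_span.intros)
qed

lemma ideal_span_subset_carrier:
  assumes "subring_carrier S" "F \<subseteq> S"
  shows "ideal_span S F \<subseteq> S"
proof
  fix a assume "a \<in> ideal_span S F"
  then show "a \<in> S" by induction (use assms in \<open>auto intro: subring_carrierD[OF assms(1)]\<close>)
qed

lemma ideal_span_finite:
  assumes S: "subring_carrier S" and "finite F" "a \<in> ideal_span S F"
  obtains u where "\<And>f. u f \<in> S" "a = (\<Sum>f\<in>F. u f * f)"
proof -
  from assms(3) have "\<exists>u. (\<forall>f. u f \<in> S) \<and> a = (\<Sum>f\<in>F. u f * f)"
  proof induction
    case zero
    show ?case by (intro exI[of _ "\<lambda>_. 0"]) (simp add: subring_carrierD[OF S])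
  next
    case (add_mult a r f)
    then obtain u where u: "\<forall>f. u f \<in> S" "a = (\<Sum>f\<in>F. u f * f)" by blast
    have "(\<Sum>g\<in>F. (u g + (if g = f then r else 0)) * g) = (\<Sum>g\<in>F. u g * g + (if g = f then r * g else 0))"
      by (intro sum.cong) (auto simp: distrib_right)
    also have "\<dots> = a + r * f"
      using \<open>f \<in> F\<close> \<open>finite F\<close> u by (simp add: sum.distrib sum.delta)
    finally show ?case
      using u add_mult(2) subring_carrierD[OF S]
      by (intro exI[of _ "\<lambda>g. u g + (if g = f then r else 0)"]) auto
  qed
  then show ?thesis using that by blast
qed

lemma ideal_span_range:
  fixes q :: "nat \<Rightarrow> 'a::comm_ring_1"
  assumes "a \<in> ideal_span S (range q)"
  obtains M where "a \<in> ideal_span S (q ` {..<M})"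
proof -
  from assms have "\<exists>M. a \<in> ideal_span S (q ` {..<M})"
  proof induction
    case zero
    show ?case by (auto intro: ideal_span.zero)
  next
    case (add_mult a r f)
    then obtain M k where M: "a \<in> ideal_span S (q ` {..<M})" "f = q k" by blast
    have "a \<in> ideal_span S (q ` {..<max M (Suc k)})"
      using ideal_span_mono[of "q ` {..<M}" "q ` {..<max M (Suc k)}" S] M(1) by force
    moreover have "f \<in> q ` {..<max M (Suc k)}" using M by auto
    ultimately show ?case using add_mult.hyps ideal_span.add_mult by blast
  qed
  then show ?thesis using that by blast
qed

section \<open>Hilbert's basis theorem\<close>

lemma subring_carrier_polys:
  assumes S: "subring_carrier S"
  shows "subring_carrier {q. \<forall>i. coeff q i \<in> S}"
  unfolding subring_carrier_def
  by (auto simp: coeff_1 coeff_mult intro!: subring_carrierD[OF S] subring_carrier_sum[OF S])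

text \<open>
  In an infinitely generated ideal, pick generators greedily by degree; a linear relation between
  their leading coefficients cancels the leading term of one of them, contradicting minimality.
\<close>

lemma noetherian_carrier_polys:
  assumes S: "subring_carrier S" and noeth: "noetherian_carrier S"
  shows "noetherian_carrier {q. \<forall>i. coeff q i \<in> S}"
  unfolding noetherian_carrier_def
proof (intro allI impI, rule ccontr)
  let ?T = "{q. \<forall>i. coeff q i \<in> S}"
  note T = subring_carrier_polys[OF S]
  fix q :: "nat \<Rightarrow> 'a poly"
  assume q: "range q \<subseteq> ?T" and not_fg: "\<nexists>N. q N \<in> ideal_span ?T (q ` {..<N})"
  define J where "J = ideal_span ?T (range q)"
  have JT: "J \<subseteq> ?T" unfolding J_def by (rule ideal_span_subset_carrier[OF T q])
  \<comment> \<open>Each element of \<open>J\<close> involves only finitely many \<open>q k\<close>,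
    so a finite set generating \<open>J\<close> would put some \<open>q M\<close> into the ideal of
    its predecessors.\<close>
  have proper: "J - ideal_span ?T A \<noteq> {}" if A: "finite A" "A \<subseteq> J" for A
  proof
    assume "J - ideal_span ?T A = {}"
    then have J: "J \<subseteq> ideal_span ?T A" by blast
    have "\<exists>M. A \<subseteq> ideal_span ?T (q ` {..<M})"
      using A
    proof (induction A rule: finite_induct)
      case (insert a A)
      then obtain M where M: "A \<subseteq> ideal_span ?T (q ` {..<M})" by blast
      obtain M' where M': "a \<in> ideal_span ?T (q ` {..<M'})"
        using ideal_span_range[of a ?T q] insert J_def by blast
      have "ideal_span ?T (q ` {..<M}) \<subseteq> ideal_span ?T (q ` {..<max M M'})"
        "ideal_span ?T (q ` {..<M'}) \<subseteq> ideal_span ?T (q ` {..<max M M'})"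
        by (intro ideal_span_mono image_mono; simp)+
      then show ?case using M M' by (intro exI[of _ "max M M'"]) blast
    qed simp
    then obtain M where M: "A \<subseteq> ideal_span ?T (q ` {..<M})" by blast
    have "q M \<in> J" unfolding J_def by (rule ideal_span_generator[OF T]) simp
    then have "q M \<in> ideal_span ?T (q ` {..<M})" using J ideal_span_least[OF T M] by blast
    then show False using not_fg by blast
  qed
  define c where "c A = arg_min degree (\<lambda>x. x \<in> J - ideal_span ?T A)" for A
  have c: "c A \<in> J - ideal_span ?T A"
    "x \<in> J - ideal_span ?T A \<Longrightarrow> degree (c A) \<le> degree x" if "finite A" "A \<subseteq> J" for A x
    using proper[OF that] arg_min_nat_lemma[of "\<lambda>x. x \<in> J - ideal_span ?T A" _ degree]
    unfolding c_def by blast+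
  define A where "A k = rec_nat {} (\<lambda>_ X. insert (c X) X) k" for k
  have A_simps: "A 0 = {}" "A (Suc k) = insert (c (A k)) (A k)" for k by (simp_all add: A_def)
  have A: "finite (A k) \<and> A k \<subseteq> J" for k
    by (induction k) (use c in \<open>auto simp: A_simps\<close>)
  define G where "G k = c (A k)" for k
  have A_eq: "A k = G ` {..<k}" for k
    by (induction k) (auto simp: A_simps G_def lessThan_Suc)
  have G: "G k \<in> J" "G k \<notin> ideal_span ?T (A k)" for k
    using c(1)[of "A k"] A unfolding G_def by auto
  \<comment> \<open>\<open>G N\<close> already lies outside the ideal of the smaller set
    \<open>A k\<close>, where \<open>G k\<close> has least degree.\<close>
  have deg_mono: "degree (G k) \<le> degree (G N)" if "k \<le> N" for k N
  proof -
    have "A k \<subseteq> A N" unfolding A_eq using that by auto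
    then have "G N \<in> J - ideal_span ?T (A k)" using G[of N] ideal_span_mono[of "A k" "A N" ?T] by blast
    then show ?thesis using c(2)[of "A k" "G N"] A unfolding G_def by blast
  qed
  have GT: "G k \<in> ?T" for k using G JT by blast
  define a where "a k = lead_coeff (G k)" for k
  have "range a \<subseteq> S" using GT unfolding a_def by auto
  then obtain N where N: "a N \<in> ideal_span S (a ` {..<N})"
    using noeth unfolding noetherian_carrier_def by blast
  \<comment> \<open>A relation between leading coefficients lifts to polynomials: each
    \<open>G k\<close> is multiplied by the power of the variable that raises its degree to that of
    \<open>G N\<close>, which is possible as the degrees never decrease.\<close>
  have "\<exists>h. h \<in> ideal_span ?T (A N) \<and> degree h \<le> degree (G N) \<and> coeff h (degree (G N)) = x"
    if "x \<in> ideal_span S (a ` {..<N})" for x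
    using that
  proof induction
    case zero
    show ?case by (intro exI[of _ 0]) (simp add: ideal_span.zero)
  next
    case (add_mult x r f)
    then obtain h k where h: "h \<in> ideal_span ?T (A N)" "degree h \<le> degree (G N)"
      "coeff h (degree (G N)) = x" and k: "f = a k" "k < N" by blast
    let ?d = "degree (G N) - degree (G k)"
    let ?m = "monom r ?d * G k"
    have "?m \<in> ideal_span ?T (A N)"
    proof (rule ideal_span_mult[OF T])
      show "monom r ?d \<in> ?T" using add_mult subring_carrierD[OF S] by (auto simp: coeff_monom)
      show "G k \<in> ideal_span ?T (A N)"
        by (rule ideal_span_generator[OF T]) (use k A_eq in auto)
    qed
    then have "h + ?m \<in> ideal_span ?T (A N)" using h ideal_span_add by blast
    moreover have "degree ?m \<le> degree (G N)"
      by (rule order_trans[OF degree_mult_le])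
        (use deg_mono[of k N] k degree_monom_le[of r ?d] in linarith)
    then have "degree (h + ?m) \<le> degree (G N)" using h by (intro degree_add_le)
    moreover have "coeff ?m (degree (G N)) = r * a k"
    proof -
      have "coeff ?m (?d + degree (G k)) = r * a k"
        unfolding coeff_monom_mult a_def by simp
      then show ?thesis using deg_mono[of k N] k by simp
    qed
    ultimately show ?case using h k by (intro exI[of _ "h + ?m"]) simp
  qed
  from this[OF N] obtain h where h: "h \<in> ideal_span ?T (A N)" "degree h \<le> degree (G N)"
    "coeff h (degree (G N)) = a N" by blast
  let ?Q = "G N - h"
  have hJ: "h \<in> J"
    using ideal_span_least[OF T, of "A N" "range q"] A h unfolding J_def by blast
  have "?Q \<in> J" unfolding J_def
    by (rule ideal_span_diff[OF T]) (use G hJ J_def in auto)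
  moreover have Q_notin: "?Q \<notin> ideal_span ?T (A N)"
  proof
    assume "?Q \<in> ideal_span ?T (A N)"
    from ideal_span_add[OF this h(1)] show False using G by simp
  qed
  ultimately have "degree (G N) \<le> degree ?Q" using c(2)[of "A N" ?Q] A unfolding G_def by blast
  moreover have "degree ?Q \<le> degree (G N)" using h by (intro degree_diff_le) auto
  moreover have "coeff ?Q (degree (G N)) = 0" using h by (simp add: a_def)
  \<comment> \<open>Minimality gives \<open>?Q\<close> the degree of \<open>G N\<close>, but the
    coefficient there has been cancelled.\<close>
  ultimately have "?Q = 0" by (metis leading_coeff_0_iff order_antisym)
  then show False using Q_notin ideal_span.zero by metis
qed

text \<open>Evaluation at \<open>y\<close> maps the polynomials over \<open>S\<close> onto the
  adjoined ring, and membership in the ideal of the predecessors survives a ring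
  homomorphism.\<close>

lemma noetherian_carrier_adjoin:
  assumes S: "subring_carrier S" and noeth: "noetherian_carrier S"
  shows "noetherian_carrier {poly q y | q. \<forall>i. coeff q i \<in> S}"
  unfolding noetherian_carrier_def
proof (intro allI impI)
  let ?T = "{q. \<forall>i. coeff q i \<in> S}" and ?R = "{poly q y | q. \<forall>i. coeff q i \<in> S}"
  fix a :: "nat \<Rightarrow> 'a" assume "range a \<subseteq> ?R"
  then have "\<forall>n. \<exists>q. q \<in> ?T \<and> a n = poly q y" by blast
  then obtain q where q: "\<And>n. q n \<in> ?T" "\<And>n. a n = poly (q n) y" by metis
  then obtain N where N: "q N \<in> ideal_span ?T (q ` {..<N})"
    using noetherian_carrier_polys[OF S noeth] unfolding noetherian_carrier_def by blast
  have "poly h y \<in> ideal_span ?R (a ` {..<N})" if "h \<in> ideal_span ?T (q ` {..<N})" for h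
    using that
  proof induction
    case (add_mult h r f)
    then obtain k where "k < N" "f = q k" by blast
    then have "poly f y \<in> a ` {..<N}" using q by auto
    moreover have "poly r y \<in> ?R" using add_mult by blast
    ultimately show ?case using add_mult.IH by (simp add: ideal_span.add_mult)
  qed (simp add: ideal_span.zero)
  from this[OF N] show "\<exists>N. a N \<in> ideal_span ?R (a ` {..<N})" using q by auto
qed

section \<open>Polynomial functions and Zariski closed sets\<close>

lemma subring_carrier_poly_functions: "subring_carrier (poly_functions I)"
  unfolding subring_carrier_def
proof (intro conjI ballI)
  show "1 \<in> poly_functions I"
    using poly_functions.const[of 1 I] by (simp add: one_fun_def)
next
  fix f g assume fg: "f \<in> poly_functions I" "g \<in> poly_functions I"
  show "f * g \<in> poly_functions I"
    using poly_functions.mult[OF fg] by (simp add: times_fun_def)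
  have "(\<lambda>x. f x + (- 1) * g x) \<in> poly_functions I"
    by (intro poly_functions.add poly_functions.mult fg poly_functions.const)
  then show "f - g \<in> poly_functions I" by (simp add: fun_diff_def)
qed

lemmas poly_functions_intros =
  subring_carrierD[OF subring_carrier_poly_functions] subring_carrier_sum[OF subring_carrier_poly_functions]
  subring_carrier_prod[OF subring_carrier_poly_functions]
  subring_carrier_power[OF subring_carrier_poly_functions] poly_functions.const poly_functions.coord

lemma coordinate_difference_poly: "i \<in> I \<Longrightarrow> (\<lambda>x. x i - c) \<in> poly_functions I"
  using poly_functions_intros(3)[OF poly_functions.coord poly_functions.const, of i I c]
  by (simp add: fun_diff_def)

lemma sum_fun_apply: "(\<Sum>a\<in>A. f a) x = (\<Sum>a\<in>A. f a x)"
  for f :: "'a \<Rightarrow> 'b \<Rightarrow> 'c::comm_monoid_add"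
  by (induction A rule: infinite_finite_induct) auto

lemma prod_fun_apply: "(\<Prod>a\<in>A. f a) x = (\<Prod>a\<in>A. f a x)"
  for f :: "'a \<Rightarrow> 'b \<Rightarrow> 'c::comm_monoid_mult"
  by (induction A rule: infinite_finite_induct) (auto simp: one_fun_def)

lemma power_fun_apply: "(f ^ k) x = f x ^ k"
  for f :: "'b \<Rightarrow> 'c::monoid_mult"
  by (induction k) (auto simp: one_fun_def)

lemma poly_functions_mono: "f \<in> poly_functions I \<Longrightarrow> I \<subseteq> J \<Longrightarrow> f \<in> poly_functions J"
  by (induction rule: poly_functions.induct) (auto intro: poly_functions.intros)

text \<open>Exhibits one more variable as the adjunction of an element, so that the basis theorem
  applies by induction on the variables. The coefficients of \<open>q\<close> are functions, and
  \<open>q\<close> is evaluated at the coordinate function in the pointwise ring.\<close>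

lemma poly_functions_insert:
  "poly_functions (insert i I) =
    {poly q (\<lambda>x. x i) | q. \<forall>k. coeff q k \<in> poly_functions I}" (is "?L = ?R")
proof
  let ?T = "{q. \<forall>k. coeff q k \<in> poly_functions I}"
  note T = subring_carrier_polys[OF subring_carrier_poly_functions[of I]]
  show "?L \<subseteq> ?R"
  proof
    fix f assume "f \<in> ?L"
    then have "\<exists>q\<in>?T. f = poly q (\<lambda>x. x i)"
    proof induction
      case (const c)
      show ?case by (intro bexI[of _ "[:\<lambda>x. c:]"])
        (auto simp: coeff_pCons split: nat.split intro: poly_functions_intros)
    next
      case (coord j)
      show ?case
      proof (cases "j = i")
        case True
        then show ?thesis by (intro bexI[of _ "[:0, 1:]"])
          (auto simp: coeff_pCons one_fun_def zero_fun_def times_fun_def split: nat.split intro: poly_functions_intros)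
      next
        case False
        then have "j \<in> I" using coord by auto
        then show ?thesis by (intro bexI[of _ "[:\<lambda>x. x j:]"])
          (auto simp: coeff_pCons split: nat.split intro: poly_functions_intros)
      qed
    next
      case (add f g)
      then obtain q r where "q \<in> ?T" "r \<in> ?T" "f = poly q (\<lambda>x. x i)" "g = poly r (\<lambda>x. x i)" by blast
      then show ?case
        by (intro bexI[of _ "q + r"] subring_carrierD[OF T]) (auto simp: fun_eq_iff)
    next
      case (mult f g)
      then obtain q r where "q \<in> ?T" "r \<in> ?T" "f = poly q (\<lambda>x. x i)" "g = poly r (\<lambda>x. x i)" by blast
      then show ?case
        by (intro bexI[of _ "q * r"] subring_carrierD[OF T]) (auto simp: fun_eq_iff)
    qed
    then show "f \<in> ?R" by blast
  qed
  show "?R \<subseteq> ?L"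
  proof
    fix f assume "f \<in> ?R"
    then obtain q where "\<forall>k. coeff q k \<in> poly_functions I" "f = poly q (\<lambda>x. x i)" by blast
    moreover from this(1) have "coeff q k \<in> ?L" for k
      using poly_functions_mono[of _ I "insert i I"] by blast
    ultimately show "f \<in> ?L" unfolding poly_altdef by (auto intro!: poly_functions_intros)
  qed
qed

lemma noetherian_carrier_poly_functions:
  assumes "finite I"
  shows "noetherian_carrier (poly_functions I)"
  using assms
proof (induction I rule: finite_induct)
  case empty
  show ?case unfolding noetherian_carrier_def
  proof (intro allI impI)
    fix a :: "nat \<Rightarrow> ('a \<Rightarrow> complex) \<Rightarrow> complex" assume a: "range a \<subseteq> poly_functions {}"
    have "\<exists>c. f = (\<lambda>x. c)" if "f \<in> poly_functions {}" for f :: "('a \<Rightarrow> complex) \<Rightarrow> complex"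
      using that by induction auto
    moreover have "a n \<in> poly_functions {}" for n using a by auto
    ultimately have "\<exists>c. a n = (\<lambda>x. c)" for n by simp
    then obtain c where c: "\<And>n. a n = (\<lambda>x. c n)" by metis
    show "\<exists>N. a N \<in> ideal_span (poly_functions {}) (a ` {..<N})"
    \<comment> \<open>Without variables the ring is the field of constants: the first element is
      zero, or the second is a multiple of it.\<close>
    proof (cases "c 0 = 0")
      case True
      then have "a 0 = 0" using c by (simp add: zero_fun_def)
      then show ?thesis by (intro exI[of _ 0]) (simp add: ideal_span.zero)
    next
      case False
      have "(\<lambda>x. c 1 / c 0) * a 0 \<in> ideal_span (poly_functions {}) (a ` {..<1})"
        by (intro ideal_span_mult ideal_span_generator subring_carrier_poly_functions poly_functions.const) auto
      moreover have "(\<lambda>x. c 1 / c 0) * a 0 = a 1" using False c by (simp add: times_fun_def)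
      ultimately show ?thesis by metis
    qed
  qed
next
  case (insert i I)
  then show ?case unfolding poly_functions_insert
    by (intro noetherian_carrier_adjoin subring_carrier_poly_functions)
qed

section \<open>Noetherian induction on closed sets\<close>

lemma ideal_span_vanishes:
  fixes F :: "('b \<Rightarrow> 'c::comm_ring_1) set"
  assumes "f \<in> ideal_span S F" "\<And>g. g \<in> F \<Longrightarrow> g x = 0"
  shows "f x = 0"
  using assms(1)
proof induction
  case (add_mult a r f)
  then show ?case using assms(2)[of f] by simp
qed simp

text \<open>In an infinite descent pick \<open>f n\<close> vanishing on \<open>Z (Suc n)\<close> but
  not at some \<open>x n\<close> in \<open>Z n\<close>. Some \<open>f N\<close> lies in the ideal of
  its predecessors, all of which vanish at \<open>x N\<close>.\<close>

lemma wf_closedin_zariski: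
  assumes "finite I"
  shows "wf {(A, B). A \<subset> B \<and> closedin (zariski_topology I) A \<and> closedin (zariski_topology I) B}"
  unfolding wf_iff_no_infinite_down_chain
proof (rule notI, elim exE)
  fix Z :: "nat \<Rightarrow> ('a \<Rightarrow> complex) set"
  assume Z: "\<forall>i. (Z (Suc i), Z i) \<in> {(A, B). A \<subset> B \<and>
    closedin (zariski_topology I) A \<and> closedin (zariski_topology I) B}"
  have "\<exists>f x. f \<in> poly_functions I \<and> x \<in> Z n \<and> f x \<noteq> 0 \<and> (\<forall>y\<in>Z (Suc n). f y = 0)" for n
  proof -
    have cl: "closedin (zariski_topology I) (Z (Suc n))" "closedin (zariski_topology I) (Z n)"
      and sub: "Z (Suc n) \<subset> Z n" using spec[OF Z, of n] by auto
    obtain F where F: "F \<subseteq> poly_functions I" "Z (Suc n) = zero_set I F"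
      using cl(1) unfolding closedin_zariski by blast
    obtain x where x: "x \<in> Z n" "x \<notin> Z (Suc n)" using sub by blast
    have "x \<in> affine_space I"
      using closedin_subset[OF cl(2)] x(1) unfolding topspace_zariski by blast
    then show ?thesis using x F unfolding zero_set_def by blast
  qed
  then obtain f x where f: "\<And>n. f n \<in> poly_functions I" and x: "\<And>n. x n \<in> Z n" "\<And>n. f n (x n) \<noteq> 0"
    and f0: "\<And>n y. y \<in> Z (Suc n) \<Longrightarrow> f n y = 0" by metis
  obtain N where N: "f N \<in> ideal_span (poly_functions I) (f ` {..<N})"
    using noetherian_carrier_poly_functions[OF assms] f unfolding noetherian_carrier_def by blast
  have "Z n \<subseteq> Z k" if "k \<le> n" for k n
    by (rule lift_Suc_antimono_le[OF _ that]) (use Z in blast)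
  then have "f k (x N) = 0" if "k < N" for k
    using f0[of "x N" k] x(1)[of N] that by (meson Suc_leI subsetD)
  then have "f N (x N) = 0" by (intro ideal_span_vanishes[OF N]) auto
  then show False using x by blast
qed

text \<open>A nonempty closed set that is not irreducible is the union of two smaller closed sets.
  The empty set does not count as irreducible and is the empty union.\<close>

lemma closedin_zariski_decompose:
  assumes "finite I" "closedin (zariski_topology I) Z"
  obtains D where "finite D" "\<Union>D = Z"
    "\<And>W. W \<in> D \<Longrightarrow> closedin (zariski_topology I) W \<and> irreducible_in (zariski_topology I) W"
proof -
  let ?T = "zariski_topology I"
  have "closedin ?T Z \<longrightarrow> (\<exists>D. finite D \<and> \<Union>D = Z \<and> (\<forall>W\<in>D. closedin ?T W \<and> irreducible_in ?T W))"
  proof (induction Z rule: wf_induct_rule[OF wf_closedin_zariski[OF assms(1)]])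
    case (1 Z)
    show ?case
    proof
      assume Z: "closedin ?T Z"
      show "\<exists>D. finite D \<and> \<Union>D = Z \<and> (\<forall>W\<in>D. closedin ?T W \<and> irreducible_in ?T W)"
      proof (cases "Z = {} \<or> irreducible_in ?T Z")
        case True
        then show ?thesis
        proof
          assume "Z = {}" then show ?thesis by (intro exI[of _ "{}"]) simp
        next
          assume "irreducible_in ?T Z" then show ?thesis using Z by (intro exI[of _ "{Z}"]) simp
        qed
      next
        case False
        then obtain A B where AB: "closedin ?T A" "closedin ?T B" "Z \<subseteq> A \<union> B" "\<not> Z \<subseteq> A" "\<not> Z \<subseteq> B"
          unfolding irreducible_in_def using closedin_subset[OF Z] by blast
        have "closedin ?T (Z \<inter> A)" "closedin ?T (Z \<inter> B)" "Z \<inter> A \<subset> Z" "Z \<inter> B \<subset> Z"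
          using AB Z by blast+
        with 1[of "Z \<inter> A"] 1[of "Z \<inter> B"] Z obtain D D' where "finite D" "finite D'" "\<Union>D = Z \<inter> A" "\<Union>D' = Z \<inter> B"
          "\<forall>W\<in>D. closedin ?T W \<and> irreducible_in ?T W" "\<forall>W\<in>D'. closedin ?T W \<and> irreducible_in ?T W"
          by auto
        then show ?thesis using AB(3) by (intro exI[of _ "D \<union> D'"]) auto
      qed
    qed
  qed
  then show ?thesis using assms(2) that by blast
qed

section \<open>The Nullstellensatz\<close>

text \<open>Gaussian elimination: a pivot \<open>b0\<close> of the row \<open>a\<close> is
  eliminated from the rows in \<open>A\<close>, and its coefficient is recovered afterwards from the
  row \<open>a\<close>.\<close>

lemma underdetermined_system:
  fixes M :: "'a \<Rightarrow> 'b \<Rightarrow> 'c::field"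
  assumes "finite A" "finite B" "card A < card B"
  obtains c where "\<exists>b\<in>B. c b \<noteq> 0" "\<And>a. a \<in> A \<Longrightarrow> (\<Sum>b\<in>B. c b * M a b) = 0"
proof -
  have "\<exists>c. (\<exists>b\<in>B. c b \<noteq> 0) \<and> (\<forall>a\<in>A. (\<Sum>b\<in>B. c b * M a b) = 0)"
    using assms
  proof (induction A arbitrary: B M rule: finite_induct)
    case empty
    then have "B \<noteq> {}" by auto
    then show ?case by (intro exI[of _ "\<lambda>_. 1"]) auto
  next
    case (insert a A)
    show ?case
    proof (cases "\<forall>b\<in>B. M a b = 0")
      case True
      have "card A < card B" using insert by simp
      from insert.IH[OF insert.prems(1) this] obtain c where
        "\<exists>b\<in>B. c b \<noteq> 0" "\<forall>a\<in>A. (\<Sum>b\<in>B. c b * M a b) = 0" by blast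
      moreover have "(\<Sum>b\<in>B. c b * M a b) = 0" using True by simp
      ultimately show ?thesis by blast
    next
      case False
      then obtain b0 where b0: "b0 \<in> B" "M a b0 \<noteq> 0" by blast
      let ?B = "B - {b0}"
      let ?M = "\<lambda>a' b. M a' b - M a b / M a b0 * M a' b0"
      have "card A < card ?B" "finite ?B" using insert b0 by simp_all
      from insert.IH[OF this(2,1), of ?M] obtain c where
        c: "\<exists>b\<in>?B. c b \<noteq> 0" "\<forall>a'\<in>A. (\<Sum>b\<in>?B. c b * ?M a' b) = 0" by (elim exE conjE)
      let ?s = "- (\<Sum>b\<in>?B. c b * M a b) / M a b0"
      let ?c = "c(b0 := ?s)"
      have eq: "(\<Sum>b\<in>B. ?c b * M a' b) = ?s * M a' b0 + (\<Sum>b\<in>?B. c b * M a' b)" for a'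
        using sum.remove[OF insert.prems(1) b0(1), of "\<lambda>b. ?c b * M a' b"] by simp
      have "(\<Sum>b\<in>B. ?c b * M a' b) = 0" if "a' \<in> insert a A" for a'
      proof (cases "a' = a")
        case True
        show ?thesis unfolding eq unfolding True using b0 by simp
      next
        case False
        then have "(\<Sum>b\<in>?B. c b * ?M a' b) = 0" using c that by auto
        moreover have "(\<Sum>b\<in>?B. c b * ?M a' b) =
            (\<Sum>b\<in>?B. c b * M a' b) - (\<Sum>b\<in>?B. c b * M a b) / M a b0 * M a' b0"
          by (simp add: sum_subtractf right_diff_distrib sum_divide_distrib sum_distrib_right mult.assoc
              times_divide_eq_left)
        ultimately show ?thesis unfolding eq by simp
      qed
      moreover have "\<exists>b\<in>B. ?c b \<noteq> 0" using c(1) by auto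
      ultimately show ?thesis by blast
    qed
  qed
  then show ?thesis using that by blast
qed

section \<open>Taylor expansions and finite-dimensional spaces of polynomials\<close>

definition shifted_monomial :: "'i set \<Rightarrow> ('i \<Rightarrow> complex) \<Rightarrow> ('i \<Rightarrow> nat) \<Rightarrow> ('i \<Rightarrow> complex) \<Rightarrow> complex" where
  "shifted_monomial I p \<alpha> = (\<lambda>x. \<Prod>i\<in>I. (x i - p i) ^ \<alpha> i)"

text \<open>Every single exponent, not the total degree, is kept below \<open>j\<close>. The
  exponents then form a box whose size is a power of \<open>j\<close>, and the sides of boxes add
  under multiplication.\<close>

definition monomial_span :: "'i set \<Rightarrow> ('i \<Rightarrow> complex) \<Rightarrow> nat \<Rightarrow> (('i \<Rightarrow> complex) \<Rightarrow> complex) set" where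
  "monomial_span I p j =
    {f. \<exists>c. f = (\<lambda>x. \<Sum>\<alpha>\<in>I \<rightarrow>\<^sub>E {..<j}. c \<alpha> * shifted_monomial I p \<alpha> x)}"

lemma finite_exponents: "finite I \<Longrightarrow> finite (I \<rightarrow>\<^sub>E {..<j::nat})"
  by (intro finite_PiE) auto

lemma shifted_monomial_poly: "shifted_monomial I p \<alpha> \<in> poly_functions I"
proof -
  have "(\<Prod>i\<in>I. ((\<lambda>x. x i) - (\<lambda>x. p i)) ^ \<alpha> i) \<in> poly_functions I"
    by (intro poly_functions_intros)
  moreover have "(\<Prod>i\<in>I. ((\<lambda>x. x i) - (\<lambda>x. p i)) ^ \<alpha> i) = shifted_monomial I p \<alpha>"
    by (simp add: shifted_monomial_def fun_eq_iff prod_fun_apply power_fun_apply)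
  ultimately show ?thesis by simp
qed

lemma monomial_span_0: "0 \<in> monomial_span I p j"
  unfolding monomial_span_def by (auto intro!: exI[of _ "\<lambda>_. 0"])

lemma monomial_span_add:
  assumes "f \<in> monomial_span I p j" "g \<in> monomial_span I p j"
  shows "f + g \<in> monomial_span I p j"
proof -
  obtain c d where "f = (\<lambda>x. \<Sum>\<alpha>\<in>I \<rightarrow>\<^sub>E {..<j}. c \<alpha> * shifted_monomial I p \<alpha> x)"
    "g = (\<lambda>x. \<Sum>\<alpha>\<in>I \<rightarrow>\<^sub>E {..<j}. d \<alpha> * shifted_monomial I p \<alpha> x)"
    using assms unfolding monomial_span_def by blast
  then show ?thesis unfolding monomial_span_def
    by (auto simp: fun_eq_iff sum.distrib distrib_right intro!: exI[of _ "\<lambda>\<alpha>. c \<alpha> + d \<alpha>"])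
qed

lemma monomial_span_scale:
  assumes "f \<in> monomial_span I p j"
  shows "(\<lambda>x. c * f x) \<in> monomial_span I p j"
proof -
  obtain d where "f = (\<lambda>x. \<Sum>\<alpha>\<in>I \<rightarrow>\<^sub>E {..<j}. d \<alpha> * shifted_monomial I p \<alpha> x)"
    using assms unfolding monomial_span_def by blast
  then show ?thesis unfolding monomial_span_def
    by (auto simp: fun_eq_iff sum_distrib_left mult.assoc intro!: exI[of _ "\<lambda>\<alpha>. c * d \<alpha>"])
qed

lemma monomial_span_sum:
  assumes "\<And>a. a \<in> A \<Longrightarrow> f a \<in> monomial_span I p j"
  shows "(\<lambda>x. \<Sum>a\<in>A. c a * f a x) \<in> monomial_span I p j"
proof -
  have "(\<Sum>a\<in>A. (\<lambda>x. c a * f a x)) \<in> monomial_span I p j"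
    using assms by (induction A rule: infinite_finite_induct)
      (auto intro: monomial_span_add monomial_span_scale monomial_span_0)
  moreover have "(\<Sum>a\<in>A. (\<lambda>x. c a * f a x)) = (\<lambda>x. \<Sum>a\<in>A. c a * f a x)"
    by (simp add: fun_eq_iff sum_fun_apply)
  ultimately show ?thesis by simp
qed

lemma monomial_span_base:
  assumes "finite I" "\<alpha> \<in> I \<rightarrow>\<^sub>E {..<j}"
  shows "shifted_monomial I p \<alpha> \<in> monomial_span I p j"
proof -
  have "(\<Sum>\<beta>\<in>I \<rightarrow>\<^sub>E {..<j}. (if \<beta> = \<alpha> then 1 else 0) * shifted_monomial I p \<beta> x)
      = shifted_monomial I p \<alpha> x" for x
  proof -
    have "(\<Sum>\<beta>\<in>I \<rightarrow>\<^sub>E {..<j}. (if \<beta> = \<alpha> then 1 else 0) * shifted_monomial I p \<beta> x)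
      = (\<Sum>\<beta>\<in>I \<rightarrow>\<^sub>E {..<j}. if \<beta> = \<alpha> then shifted_monomial I p \<beta> x else 0)"
      by (intro sum.cong) auto
    then show ?thesis using assms finite_exponents[OF assms(1)] by (simp add: sum.delta)
  qed
  then show ?thesis unfolding monomial_span_def
    by (auto simp: fun_eq_iff intro!: exI[of _ "\<lambda>\<beta>. if \<beta> = \<alpha> then 1 else 0"])
qed

lemma monomial_span_mono:
  assumes "finite I" "j \<le> k"
  shows "monomial_span I p j \<subseteq> monomial_span I p k"
proof
  fix f assume "f \<in> monomial_span I p j"
  then obtain c where f: "f = (\<lambda>x. \<Sum>\<alpha>\<in>I \<rightarrow>\<^sub>E {..<j}. c \<alpha> * shifted_monomial I p \<alpha> x)"
    unfolding monomial_span_def by blast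
  show "f \<in> monomial_span I p k"
    unfolding f
  proof (rule monomial_span_sum)
    fix \<alpha> assume "\<alpha> \<in> I \<rightarrow>\<^sub>E {..<j}"
    then have "\<alpha> \<in> I \<rightarrow>\<^sub>E {..<k}" using assms(2) by (auto simp: PiE_iff)
    then show "shifted_monomial I p \<alpha> \<in> monomial_span I p k" by (rule monomial_span_base[OF assms(1)])
  qed
qed

lemma shifted_monomial_mult:
  "shifted_monomial I p \<alpha> x * shifted_monomial I p \<beta> x =
    shifted_monomial I p (\<lambda>i\<in>I. \<alpha> i + \<beta> i) x"
  unfolding shifted_monomial_def prod.distrib[symmetric]
  by (intro prod.cong) (auto simp: power_add)

lemma monomial_span_mult:
  assumes "finite I" "f \<in> monomial_span I p j" "g \<in> monomial_span I p k"
  shows "f * g \<in> monomial_span I p (j + k)"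
proof -
  obtain c d where fg: "f = (\<lambda>x. \<Sum>\<alpha>\<in>I \<rightarrow>\<^sub>E {..<j}. c \<alpha> * shifted_monomial I p \<alpha> x)"
    "g = (\<lambda>x. \<Sum>\<alpha>\<in>I \<rightarrow>\<^sub>E {..<k}. d \<alpha> * shifted_monomial I p \<alpha> x)"
    using assms unfolding monomial_span_def by blast
  have "f * g = (\<lambda>x. \<Sum>\<alpha>\<in>I \<rightarrow>\<^sub>E {..<j}. c \<alpha> * (\<Sum>\<beta>\<in>I \<rightarrow>\<^sub>E {..<k}. d \<beta> *
      shifted_monomial I p (\<lambda>i\<in>I. \<alpha> i + \<beta> i) x))"
    unfolding fg times_fun_def sum_product
    by (intro ext sum.cong refl) (simp add: shifted_monomial_mult[symmetric] sum_distrib_left mult_ac)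
  moreover have "\<dots> \<in> monomial_span I p (j + k)"
  proof (intro monomial_span_sum monomial_span_base[OF assms(1)])
    fix \<alpha> \<beta> assume "\<alpha> \<in> I \<rightarrow>\<^sub>E {..<j}" "\<beta> \<in> I \<rightarrow>\<^sub>E {..<k}"
    then have "\<alpha> i + \<beta> i < j + k" if "i \<in> I" for i
      using that by (simp add: PiE_iff add_strict_mono)
    then show "(\<lambda>i\<in>I. \<alpha> i + \<beta> i) \<in> I \<rightarrow>\<^sub>E {..<j + k}" by auto
  qed
  ultimately show ?thesis by simp
qed

text \<open>Taylor expansion at \<open>p\<close>, by induction on the construction of
  \<open>f\<close>. It makes the polynomial functions a countable union of finite-dimensional
  spaces.\<close>

lemma poly_functions_monomial_span:
  assumes "finite I" "f \<in> poly_functions I"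
  obtains j where "f \<in> monomial_span I p j"
proof -
  have consts_in: "(\<lambda>x. c) \<in> monomial_span I p j" if "j > 0" for c j
  proof -
    have "shifted_monomial I p (\<lambda>i\<in>I. 0) \<in> monomial_span I p j"
      by (rule monomial_span_base[OF assms(1)]) (use that in auto)
    from monomial_span_scale[OF this, of c] show ?thesis by (simp add: shifted_monomial_def)
  qed
  from assms(2) have "\<exists>j. f \<in> monomial_span I p j"
  proof induction
    case (const c)
    show ?case using consts_in[of 1 c] by auto
  next
    case (coord i)
    \<comment> \<open>A coordinate is \<open>(x i - p i) + p i\<close>, with exponents
      \<open>0\<close> and \<open>1\<close>, hence a box of side \<open>2\<close>.\<close>
    have "shifted_monomial I p (\<lambda>k\<in>I. if k = i then 1 else 0) \<in> monomial_span I p 2"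
      by (rule monomial_span_base[OF assms(1)]) auto
    moreover have "shifted_monomial I p (\<lambda>k\<in>I. if k = i then 1 else 0) = (\<lambda>x. x i - p i)"
    proof
      fix x
      have "shifted_monomial I p (\<lambda>k\<in>I. if k = i then 1 else 0) x
        = (\<Prod>k\<in>I. if k = i then x k - p k else 1)"
        unfolding shifted_monomial_def by (intro prod.cong) auto
      also have "\<dots> = x i - p i" using coord assms(1) by (simp add: prod.delta)
      finally show "shifted_monomial I p (\<lambda>k\<in>I. if k = i then 1 else 0) x = x i - p i" .
    qed
    ultimately have "(\<lambda>x. x i - p i) + (\<lambda>x. p i) \<in> monomial_span I p 2"
      using consts_in[of 2 "p i"] by (intro monomial_span_add) auto
    then show ?case by (auto simp: plus_fun_def)
  next
    case (add f g)
    then obtain j k where "f \<in> monomial_span I p j" "g \<in> monomial_span I p k" by blast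
    then have "f + g \<in> monomial_span I p (max j k)"
      using monomial_span_mono[OF assms(1), of j "max j k" p] monomial_span_mono[OF assms(1), of k "max j k" p]
      by (intro monomial_span_add) auto
    then show ?case by (auto simp: plus_fun_def)
  next
    case (mult f g)
    then obtain j k where "f \<in> monomial_span I p j" "g \<in> monomial_span I p k" by blast
    from monomial_span_mult[OF assms(1) this] show ?case by (auto simp: times_fun_def)
  qed
  then show ?thesis using that by blast
qed

lemma univariate_poly_functions:
  assumes "i \<in> I"
  shows "(\<lambda>x. poly q (x i)) \<in> poly_functions I"
proof -
  have "(\<Sum>k\<le>degree q. (\<lambda>x. coeff q k) * (\<lambda>x. x i) ^ k) \<in> poly_functions I"
    using assms by (intro poly_functions_intros)
  moreover have "(\<Sum>k\<le>degree q. (\<lambda>x. coeff q k) * (\<lambda>x. x i) ^ k) = (\<lambda>x. poly q (x i))"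
    by (simp add: fun_eq_iff sum_fun_apply power_fun_apply poly_altdef)
  ultimately show ?thesis by simp
qed

text \<open>
  Let \<open>P\<close> be an ideal maximal among those avoiding all powers of \<open>h\<close>. If no \<open>x\<^sub>i - \<lambda>\<close> lay in \<open>P\<close>,
  then modulo \<open>P\<close> and up to powers of \<open>h\<close> the uncountably many \<open>x\<^sub>i - \<lambda>\<close> would have inverses \<open>u\<^sub>\<lambda>\<close>.
  As the polynomials form a countable union of finite-dimensional spaces, there is a linear relation
  between the \<open>u\<^sub>\<lambda>\<close>, and clearing denominators makes \<open>x\<^sub>i\<close> algebraic modulo \<open>P\<close>.
\<close>

theorem nullstellensatz:
  fixes I :: "'i set"
  assumes fin: "finite I" and F: "F \<subseteq> poly_functions I" and h: "h \<in> poly_functions I"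
    and vanish: "\<And>x. x \<in> zero_set I F \<Longrightarrow> h x = 0"
  obtains k where "h ^ k \<in> ideal_span (poly_functions I) F"
proof (rule ccontr)
  let ?R = "poly_functions I"
  note R = subring_carrier_poly_functions[of I]
  assume "\<not> thesis"
  then have no: "h ^ k \<notin> ideal_span ?R F" for k using that by blast
  define \<A> where "\<A> = {P. F \<subseteq> P \<and> P \<subseteq> ?R \<and> ideal_span ?R P \<subseteq> P \<and> (\<forall>k. h ^ k \<notin> P)}"
  have "\<exists>P\<in>\<A>. \<forall>X\<in>\<A>. P \<subseteq> X \<longrightarrow> X = P"
  proof (rule subset_Zorn_nonempty)
    have "ideal_span ?R F \<in> \<A>"
      unfolding \<A>_def using no ideal_span_subset_carrier[OF R F] ideal_span_generator[OF R]
        ideal_span_least[OF R, of "ideal_span ?R F" F] by blast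
    then show "\<A> \<noteq> {}" by blast
  next
    fix C assume C: "C \<noteq> {}" "subset.chain \<A> C"
    have CA: "X \<in> \<A>" if "X \<in> C" for X using C(2) that by (auto simp: subset.chain_def)
    have "f \<in> \<Union>C" if "f \<in> ideal_span ?R (\<Union>C)" for f
      using that
    proof induction
      case zero
      obtain X where "X \<in> C" using C by blast
      then show ?case using CA[of X] ideal_span.zero[of ?R X] unfolding \<A>_def by blast
    next
      case (add_mult a r f)
      then obtain X Y where XY: "X \<in> C" "Y \<in> C" "a \<in> X" "f \<in> Y" by blast
      then have "X \<subseteq> Y \<or> Y \<subseteq> X" using C(2) by (auto simp: subset.chain_def)
      then obtain W where W: "W \<in> C" "a \<in> W" "f \<in> W" using XY by blast
      then have "a + r * f \<in> ideal_span ?R W"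
        using add_mult.hyps ideal_span_generator[OF R] by (intro ideal_span.add_mult) auto
      then show ?case using W CA[of W] unfolding \<A>_def by blast
    qed
    then show "\<Union>C \<in> \<A>" using CA C(1) unfolding \<A>_def by blast
  qed
  then obtain P where P: "P \<in> \<A>" and max: "\<And>X. X \<in> \<A> \<Longrightarrow> P \<subseteq> X \<Longrightarrow> X = P" by blast
  have PR: "P \<subseteq> ?R" "F \<subseteq> P" and hP: "h ^ k \<notin> P" for k using P unfolding \<A>_def by auto
  have span_eq: "ideal_span ?R P = P" using P ideal_span_generator[OF R] unfolding \<A>_def by blast
  have P_add: "a + b \<in> P" if "a \<in> P" "b \<in> P" for a b using ideal_span_add[of b ?R P a] that span_eq by simp
  have P_mult: "r * a \<in> P" if "a \<in> P" "r \<in> ?R" for a r using ideal_span_mult[OF R, of r a P] that span_eq by simp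
  have P_diff: "a - b \<in> P" if "a \<in> P" "b \<in> P" for a b using ideal_span_diff[OF R, of a P b] that span_eq by simp
  have P_sum: "sum f A \<in> P" if "\<And>x. x \<in> A \<Longrightarrow> f x \<in> P" for f and A :: "complex set"
    using ideal_span_sum[of A f ?R P] that span_eq by simp
  \<comment> \<open>Adding \<open>e\<close> to \<open>P\<close> gives a strictly larger ideal, which
    by maximality contains a power of \<open>h\<close>.\<close>
  have inverse: "\<exists>k u. u \<in> ?R \<and> h ^ k - u * e \<in> P" if e: "e \<in> ?R" "e \<notin> P" for e
  proof -
    let ?Q = "ideal_span ?R (insert e P)"
    have PQ: "P \<subseteq> ?Q" "e \<in> ?Q" using ideal_span_generator[OF R] by blast+
    then have "?Q \<noteq> P" using e by blast
    then have "?Q \<notin> \<A>" using max PQ by blast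
    moreover have "F \<subseteq> ?Q" "?Q \<subseteq> ?R" "ideal_span ?R ?Q \<subseteq> ?Q"
      using PQ PR ideal_span_subset_carrier[OF R, of "insert e P"] ideal_span_least[OF R, of ?Q "insert e P"] e
      by blast+
    ultimately obtain k where k: "h ^ k \<in> ?Q" unfolding \<A>_def by blast
    have "\<exists>u. u \<in> ?R \<and> f - u * e \<in> P" if "f \<in> ?Q" for f
      using that
    proof induction
      case zero
      show ?case using ideal_span.zero[of ?R P] span_eq poly_functions_intros(1)[of I]
        by (metis diff_zero mult_zero_left)
    next
      case (add_mult a r f)
      then obtain u where u: "u \<in> ?R" "a - u * e \<in> P" by blast
      show ?case
      proof (cases "f = e")
        case True
        have "a + r * f - (u + r) * e = a - u * e" unfolding True by (simp add: algebra_simps)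
        then show ?thesis using u poly_functions_intros(4)[OF u(1) add_mult.hyps(2)] by metis
      next
        case False
        then have "r * f \<in> P" using add_mult P_mult by blast
        then have "(a - u * e) + r * f \<in> P" using u P_add by blast
        moreover have "(a - u * e) + r * f = a + r * f - u * e" by (simp add: algebra_simps)
        ultimately show ?thesis using u by metis
      qed
    qed
    from this[OF k] show ?thesis by blast
  qed
  have "\<exists>\<mu>. (\<lambda>x. x i - \<mu>) \<in> P" if i: "i \<in> I" for i
  proof (rule ccontr)
    assume none: "\<nexists>\<mu>. (\<lambda>x. x i - \<mu>) \<in> P"
    have "\<exists>k u. u \<in> ?R \<and> h ^ k - u * (\<lambda>x. x i - \<mu>) \<in> P" for \<mu>
      using inverse[OF coordinate_difference_poly[OF i, of \<mu>]] none by blast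
    then obtain k u where u: "\<And>\<mu>. u \<mu> \<in> ?R" "\<And>\<mu>. h ^ k \<mu> - u \<mu> * (\<lambda>x. x i - \<mu>) \<in> P"
      by metis
    \<comment> \<open>The roots of \<open>q\<close> are split off one at a time: multiplication by
      \<open>u \<mu>\<close> turns the factor \<open>x i - \<mu>\<close> into a power of
      \<open>h\<close> modulo \<open>P\<close>, until only a constant is left.\<close>
    have not_algebraic: "h ^ a * (\<lambda>x. poly q (x i)) \<notin> P" if "q \<noteq> 0" for a q
      using that
    proof (induction "degree q" arbitrary: q a)
      case 0
      then obtain c where c: "q = [:c:]" "c \<noteq> 0" by (metis degree_eq_zeroE pCons_0_0)
      show ?case
      proof
        assume "h ^ a * (\<lambda>x. poly q (x i)) \<in> P"
        then have "(\<lambda>x. 1 / c) * (h ^ a * (\<lambda>x. poly q (x i))) \<in> P"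
          by (rule P_mult[OF _ poly_functions.const])
        moreover have "(\<lambda>x. 1 / c) * (h ^ a * (\<lambda>x. poly q (x i))) = h ^ a"
          using c by (simp add: fun_eq_iff)
        ultimately show False using hP by simp
      qed
    next
      case (Suc d)
      then have "\<not> constant (poly q)" by (simp add: constant_degree)
      then obtain \<mu> where "poly q \<mu> = 0" using fundamental_theorem_of_algebra by blast
      then obtain q' where q': "q = [:- \<mu>, 1:] * q'" by (metis poly_eq_0_iff_dvd dvdE)
      with Suc have "q' \<noteq> 0" by auto
      then have d: "d = degree q'" using Suc(2) q' by (simp add: degree_mult_eq del: mult_pCons_left)
      show ?case
      proof
        assume "h ^ a * (\<lambda>x. poly q (x i)) \<in> P"
        then have 1: "u \<mu> * (h ^ a * (\<lambda>x. poly q (x i))) \<in> P" by (rule P_mult[OF _ u(1)])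
        have "h ^ a * (\<lambda>x. poly q' (x i)) * (h ^ k \<mu> - u \<mu> * (\<lambda>x. x i - \<mu>)) \<in> P"
          using u h i by (intro P_mult) (auto intro!: poly_functions_intros univariate_poly_functions)
        from P_add[OF this 1] have "h ^ (a + k \<mu>) * (\<lambda>x. poly q' (x i)) \<in> P"
          unfolding q' power_add by (simp add: algebra_simps fun_eq_iff times_fun_def fun_diff_def plus_fun_def)
        then show False using Suc(1)[OF d \<open>q' \<noteq> 0\<close>] by blast
      qed
    qed
    have "\<exists>j. u \<mu> \<in> monomial_span I (\<lambda>_. 0) j" for \<mu>
      using poly_functions_monomial_span[OF fin u(1)] by metis
    then obtain j where j: "\<And>\<mu>. u \<mu> \<in> monomial_span I (\<lambda>_. 0) (j \<mu>)" by metis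
    \<comment> \<open>Pigeonhole: there are uncountably many real \<open>\<mu>\<close> but only
      countably many pairs of an exponent of \<open>h\<close> and a box side, so one pair serves
      infinitely many \<open>\<mu>\<close>.\<close>
    let ?kj = "\<lambda>r::real. (k (complex_of_real r), j (complex_of_real r))"
    have "\<exists>y. infinite (?kj -` {y})"
    proof (rule ccontr)
      assume "\<nexists>y. infinite (?kj -` {y})"
      then have "countable (\<Union>y. ?kj -` {y})" by (intro countable_UN) (auto intro: countable_finite)
      moreover have "(\<Union>y. ?kj -` {y}) = UNIV" by blast
      ultimately show False using uncountable_UNIV_real by simp
    qed
    then obtain k0 j0 where inf: "infinite (?kj -` {(k0, j0)})" by auto
    let ?E = "I \<rightarrow>\<^sub>E {..<j0}"
    \<comment> \<open>One element more than there are monomials in the box, which forces a linear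
      relation between the \<open>u \<mu>\<close>.\<close>
    obtain L0 where L0: "finite L0" "card L0 = Suc (card ?E)" "L0 \<subseteq> ?kj -` {(k0, j0)}"
      using infinite_arbitrarily_large[OF inf] by blast
    define L where "L = complex_of_real ` L0"
    have L: "finite L" "card ?E < card L" using L0 by (auto simp: L_def card_image inj_on_def)
    have kj: "k \<mu> = k0" "j \<mu> = j0" if "\<mu> \<in> L" for \<mu> using that L0(3) unfolding L_def by auto
    have "\<exists>c. u \<mu> = (\<lambda>x. \<Sum>\<alpha>\<in>?E. c \<alpha> * shifted_monomial I (\<lambda>_. 0) \<alpha> x)" if "\<mu> \<in> L" for \<mu>
      using j[of \<mu>] unfolding kj[OF that] monomial_span_def by blast
    then obtain c where c: "\<And>\<mu>. \<mu> \<in> L \<Longrightarrow>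
        u \<mu> = (\<lambda>x. \<Sum>\<alpha>\<in>?E. c \<mu> \<alpha> * shifted_monomial I (\<lambda>_. 0) \<alpha> x)" by metis
    obtain e where e: "\<exists>\<mu>\<in>L. e \<mu> \<noteq> 0" "\<And>\<alpha>. \<alpha> \<in> ?E \<Longrightarrow> (\<Sum>\<mu>\<in>L. e \<mu> * c \<mu> \<alpha>) = 0"
      using underdetermined_system[OF finite_exponents[OF fin] L, of "\<lambda>\<alpha> \<mu>. c \<mu> \<alpha>"] by blast
    have relation: "(\<Sum>\<mu>\<in>L. e \<mu> * u \<mu> x) = 0" for x
    proof -
      have "(\<Sum>\<mu>\<in>L. e \<mu> * u \<mu> x) =
          (\<Sum>\<mu>\<in>L. \<Sum>\<alpha>\<in>?E. e \<mu> * c \<mu> \<alpha> * shifted_monomial I (\<lambda>_. 0) \<alpha> x)"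
        by (intro sum.cong refl) (simp add: c sum_distrib_left mult.assoc)
      also have "\<dots> = (\<Sum>\<alpha>\<in>?E. (\<Sum>\<mu>\<in>L. e \<mu> * c \<mu> \<alpha>) * shifted_monomial I (\<lambda>_. 0) \<alpha> x)"
        by (subst sum.swap) (simp add: sum_distrib_right)
      also have "\<dots> = 0" using e by simp
      finally show ?thesis .
    qed
    \<comment> \<open>The numerator of the sum of the fractions \<open>e \<mu> / (X - \<mu>)\<close>
      over the common denominator. It is nonzero because at \<open>\<mu>0\<close> only the term of
      \<open>\<mu>0\<close> survives.\<close>
    define q where "q = (\<Sum>\<mu>\<in>L. Polynomial.smult (e \<mu>) (\<Prod>\<nu>\<in>L - {\<mu>}. [:- \<nu>, 1:]))"
    obtain \<mu>0 where \<mu>0: "\<mu>0 \<in> L" "e \<mu>0 \<noteq> 0" using e by blast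
    have "poly q \<mu>0 = (\<Sum>\<mu>\<in>L. if \<mu> = \<mu>0 then e \<mu> * (\<Prod>\<nu>\<in>L - {\<mu>}. \<mu>0 - \<nu>) else 0)"
      unfolding q_def poly_sum using L(1) \<mu>0(1)
      by (intro sum.cong refl) (auto simp: poly_prod prod_zero_iff)
    also have "\<dots> = e \<mu>0 * (\<Prod>\<nu>\<in>L - {\<mu>0}. \<mu>0 - \<nu>)" using L \<mu>0 by (simp add: sum.delta)
    also have "\<dots> \<noteq> 0" using L \<mu>0 by (auto simp: prod_zero_iff)
    finally have "q \<noteq> 0" by auto
    \<comment> \<open>In the sum of the congruences, each weighted by its numerator, every
      \<open>u \<mu>\<close> has the full product over \<open>L\<close> as a factor. The relation
      between the \<open>u \<mu>\<close> removes that part and leaves \<open>h ^ k0\<close> times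
      \<open>q\<close>.\<close>
    have "(\<Sum>\<mu>\<in>L. (\<lambda>x. e \<mu> * (\<Prod>\<nu>\<in>L - {\<mu>}. x i - \<nu>)) * (h ^ k \<mu> - u \<mu> * (\<lambda>x. x i - \<mu>))) \<in> P"
    proof (intro P_sum P_mult u(2))
      fix \<mu>
      have "(\<lambda>x. poly (Polynomial.smult (e \<mu>) (\<Prod>\<nu>\<in>L - {\<mu>}. [:- \<nu>, 1:])) (x i)) \<in> ?R"
        by (rule univariate_poly_functions[OF i])
      then show "(\<lambda>x. e \<mu> * (\<Prod>\<nu>\<in>L - {\<mu>}. x i - \<nu>)) \<in> ?R" by (simp add: poly_prod)
    qed
    also have "(\<Sum>\<mu>\<in>L. (\<lambda>x. e \<mu> * (\<Prod>\<nu>\<in>L - {\<mu>}. x i - \<nu>)) * (h ^ k \<mu> - u \<mu> * (\<lambda>x. x i - \<mu>)))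
        = h ^ k0 * (\<lambda>x. poly q (x i))"
    proof
      fix x :: "'i \<Rightarrow> complex"
      have split: "(\<Prod>\<nu>\<in>L. x i - \<nu>) = (\<Prod>\<nu>\<in>L - {\<mu>}. x i - \<nu>) * (x i - \<mu>)" if "\<mu> \<in> L" for \<mu>
        using L that by (simp add: prod.remove mult.commute)
      have "e \<mu> * (\<Prod>\<nu>\<in>L - {\<mu>}. x i - \<nu>) * (h x ^ k \<mu> - u \<mu> x * (x i - \<mu>))
          = h x ^ k0 * (e \<mu> * (\<Prod>\<nu>\<in>L - {\<mu>}. x i - \<nu>)) - (e \<mu> * u \<mu> x) * (\<Prod>\<nu>\<in>L. x i - \<nu>)"
        if "\<mu> \<in> L" for \<mu> unfolding split[OF that] kj[OF that] by (simp add: algebra_simps)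
      then have "(\<Sum>\<mu>\<in>L. (\<lambda>x. e \<mu> * (\<Prod>\<nu>\<in>L - {\<mu>}. x i - \<nu>)) * (h ^ k \<mu> - u \<mu> * (\<lambda>x. x i - \<mu>))) x
          = (\<Sum>\<mu>\<in>L. h x ^ k0 * (e \<mu> * (\<Prod>\<nu>\<in>L - {\<mu>}. x i - \<nu>)) - (e \<mu> * u \<mu> x) * (\<Prod>\<nu>\<in>L. x i - \<nu>))"
        unfolding sum_fun_apply by (intro sum.cong refl) (simp add: power_fun_apply)
      also have "\<dots> = h x ^ k0 * (\<Sum>\<mu>\<in>L. e \<mu> * (\<Prod>\<nu>\<in>L - {\<mu>}. x i - \<nu>))
          - (\<Sum>\<mu>\<in>L. e \<mu> * u \<mu> x) * (\<Prod>\<nu>\<in>L. x i - \<nu>)"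
        by (simp add: sum_subtractf sum_distrib_left sum_distrib_right)
      also have "\<dots> = (h ^ k0 * (\<lambda>x. poly q (x i))) x"
        using relation[of x] by (simp add: q_def poly_sum poly_prod power_fun_apply)
      finally show "(\<Sum>\<mu>\<in>L. (\<lambda>x. e \<mu> * (\<Prod>\<nu>\<in>L - {\<mu>}. x i - \<nu>)) * (h ^ k \<mu> - u \<mu> * (\<lambda>x. x i - \<mu>))) x
          = (h ^ k0 * (\<lambda>x. poly q (x i))) x" .
    qed
    finally show False using not_algebraic[OF \<open>q \<noteq> 0\<close>] by blast
  qed
  then obtain z0 where z0: "\<And>i. i \<in> I \<Longrightarrow> (\<lambda>x. x i - z0 i) \<in> P" by metis
  define z where "z = restrict z0 I"
  have z: "z \<in> affine_space I" unfolding z_def affine_space_def by auto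
  \<comment> \<open>Modulo \<open>P\<close> every polynomial function equals its value at
    \<open>z\<close>. As \<open>P\<close> contains no nonzero constant, \<open>z\<close> is a common
    zero of \<open>F\<close>, and then \<open>h z = 0\<close> puts \<open>h\<close> into
    \<open>P\<close>.\<close>
  have eval: "f - (\<lambda>x. f z) \<in> P" if "f \<in> ?R" for f
    using that
  proof induction
    case (const c)
    show ?case using ideal_span.zero[of ?R P] span_eq by (simp add: fun_diff_def zero_fun_def)
  next
    case (coord i)
    then show ?case using z0[OF coord] by (simp add: fun_diff_def z_def)
  next
    case (add f g)
    from P_add[OF add.IH] show ?case by (simp add: fun_diff_def plus_fun_def algebra_simps)
  next
    case (mult f g)
    have "g * (f - (\<lambda>x. f z)) + (\<lambda>x. f z) * (g - (\<lambda>x. g z)) \<in> P"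
      using mult by (intro P_add P_mult[OF mult.IH(1)] P_mult[OF mult.IH(2)] poly_functions.const)
    then show ?case by (simp add: fun_diff_def plus_fun_def times_fun_def algebra_simps)
  qed
  have const_in_P: "c = 0" if "(\<lambda>x. c) \<in> P" for c
  proof (rule ccontr)
    assume "c \<noteq> 0"
    from P_mult[OF that poly_functions.const[of "1 / c"]] this have "1 \<in> P"
      by (simp add: times_fun_def one_fun_def)
    then show False using hP[of 0] by simp
  qed
  have "f z = 0" if "f \<in> F" for f
  proof -
    have "f - (f - (\<lambda>x. f z)) \<in> P" using that PR F by (intro P_diff eval) auto
    then show ?thesis by (intro const_in_P) simp
  qed
  then have "h z = 0" using z by (intro vanish) (auto simp: zero_set_def)
  then have "h \<in> P" using eval[OF h] by (simp add: fun_diff_def)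
  then show False using hP[of 1] by simp
qed

section \<open>Isolated zeros\<close>

lemma digits_unique:
  fixes u v :: "nat \<Rightarrow> nat"
  assumes "\<And>k. k < m \<Longrightarrow> u k < a" "\<And>k. k < m \<Longrightarrow> v k < a"
    and "(\<Sum>k<m. u k * a ^ k) = (\<Sum>k<m. v k * a ^ k)" and "k < m"
  shows "u k = v k"
  using assms
proof (induction m arbitrary: u v k)
  case (Suc m)
  have shift: "(\<Sum>k<Suc m. w k * a ^ k) = w 0 + a * (\<Sum>k<m. w (Suc k) * a ^ k)" for w :: "nat \<Rightarrow> nat"
    by (simp add: sum.lessThan_Suc_shift sum_distrib_left mult_ac del: sum.lessThan_Suc)
  have eq: "u 0 + a * (\<Sum>k<m. u (Suc k) * a ^ k) = v 0 + a * (\<Sum>k<m. v (Suc k) * a ^ k)"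
    using Suc.prems(3) unfolding shift .
  have lt: "u 0 < a" "v 0 < a" using Suc.prems by auto
  have "u 0 = v 0" using arg_cong[OF eq, of "\<lambda>n. n mod a"] lt by simp
  moreover from this have "(\<Sum>k<m. u (Suc k) * a ^ k) = (\<Sum>k<m. v (Suc k) * a ^ k)" using eq lt by auto
  then have "u (Suc k) = v (Suc k)" if "k < m" for k
    using Suc.IH[of "\<lambda>k. u (Suc k)" "\<lambda>k. v (Suc k)" k] Suc.prems that by auto
  ultimately show ?case using \<open>k < Suc m\<close> by (cases k) auto
qed simp

text \<open>The substitution \<open>x\<^sub>k = p\<^sub>k + t\<^bsup>a^k\<^esup>\<close> sends the monomials to distinct powers of \<open>t\<close>.\<close>

lemma shifted_monomials_independent:
  assumes fin: "finite I" and "\<alpha>0 \<in> I \<rightarrow>\<^sub>E {..<a}" "e \<alpha>0 \<noteq> 0"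
  obtains x where "(\<Sum>\<alpha>\<in>I \<rightarrow>\<^sub>E {..<a}. e \<alpha> * shifted_monomial I p \<alpha> x) \<noteq> 0"
proof -
  let ?E = "I \<rightarrow>\<^sub>E {..<a}"
  obtain b where b: "bij_betw b I {..<card I}"
    using ex_bij_betw_finite_nat[OF fin] by (auto simp: atLeast0LessThan)
  \<comment> \<open>The exponents are read as digits in base \<open>a\<close>; the bijection
    \<open>b\<close> assigns the places.\<close>
  define N where "N \<alpha> = (\<Sum>i\<in>I. \<alpha> i * a ^ b i)" for \<alpha>
  have inj: "\<alpha> = \<beta>" if \<alpha>\<beta>: "\<alpha> \<in> ?E" "\<beta> \<in> ?E" "N \<alpha> = N \<beta>" for \<alpha> \<beta>
  proof -
    let ?c = "inv_into I b"
    have c: "bij_betw ?c {..<card I} I" by (rule bij_betw_inv_into[OF b])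
    have N: "N \<alpha> = (\<Sum>k<card I. \<alpha> (?c k) * a ^ k)" for \<alpha>
      unfolding N_def
      by (subst sum.reindex_bij_betw[OF c, symmetric], rule sum.cong)
        (use bij_betw_inv_into_right[OF b] in auto)
    have "\<alpha> (?c k) = \<beta> (?c k)" if "k < card I" for k
    proof (rule digits_unique[where m = "card I" and a = a
          and u = "\<lambda>k. \<alpha> (?c k)" and v = "\<lambda>k. \<beta> (?c k)"])
      show "\<alpha> (?c k) < a" "\<beta> (?c k) < a" if "k < card I" for k
        using \<alpha>\<beta> bij_betwE[OF c] that by (auto simp: PiE_iff)
    qed (use \<alpha>\<beta> N that in auto)
    then have "\<alpha> i = \<beta> i" if "i \<in> I" for i
      using bij_betwE[OF b] bij_betw_inv_into_left[OF b that] that by force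
    then show ?thesis using \<alpha>\<beta> by (intro PiE_ext[where k = I])
  qed
  define \<psi> where "\<psi> = (\<Sum>\<alpha>\<in>?E. monom (e \<alpha>) (N \<alpha>))"
  have "coeff \<psi> (N \<alpha>0) = (\<Sum>\<alpha>\<in>?E. if \<alpha> = \<alpha>0 then e \<alpha> else 0)"
    unfolding \<psi>_def coeff_sum by (intro sum.cong refl) (use inj assms(2) in \<open>auto simp: coeff_monom\<close>)
  also have "\<dots> = e \<alpha>0" using assms finite_exponents[OF fin] by (simp add: sum.delta)
  finally have "\<psi> \<noteq> 0" using assms by auto
  then obtain t where t: "poly \<psi> t \<noteq> 0" using poly_all_0_iff_0 by blast
  have "shifted_monomial I p \<alpha> (\<lambda>i. p i + t ^ (a ^ b i)) = t ^ N \<alpha>" for \<alpha>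
    unfolding shifted_monomial_def N_def power_sum
    by (intro prod.cong) (auto simp: power_mult[symmetric] mult.commute)
  then have "(\<Sum>\<alpha>\<in>?E. e \<alpha> * shifted_monomial I p \<alpha> (\<lambda>i. p i + t ^ (a ^ b i))) = poly \<psi> t"
    by (simp add: \<psi>_def poly_sum poly_monom)
  then show ?thesis using t that by metis
qed

text \<open>Stands in for the \<open>j\<close>-th power of the maximal ideal at \<open>p\<close>: on
  each line \<open>p + t v\<close> the function is a polynomial in \<open>t\<close> divisible by
  \<open>t ^ j\<close>. The quotient \<open>q\<close> may depend on the direction
  \<open>v\<close>.\<close>

definition vanishing_to_order :: "('i \<Rightarrow> complex) \<Rightarrow> nat \<Rightarrow> (('i \<Rightarrow> complex) \<Rightarrow> complex) set" where
  "vanishing_to_order p j = {h. \<forall>v. \<exists>q. \<forall>t. h (\<lambda>i. p i + t * v i) = t ^ j * poly q t}"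

lemma vanishing_to_order_add:
  assumes "f \<in> vanishing_to_order p j" "g \<in> vanishing_to_order p j"
  shows "f + g \<in> vanishing_to_order p j"
  unfolding vanishing_to_order_def
proof (intro CollectI allI)
  fix v
  obtain q r where "\<forall>t. f (\<lambda>i. p i + t * v i) = t ^ j * poly q t" "\<forall>t. g (\<lambda>i. p i + t * v i) = t ^ j * poly r t"
    using assms unfolding vanishing_to_order_def by blast
  then show "\<exists>q. \<forall>t. (f + g) (\<lambda>i. p i + t * v i) = t ^ j * poly q t"
    by (intro exI[of _ "q + r"]) (simp add: distrib_left)
qed

lemma vanishing_to_order_mult:
  assumes "f \<in> vanishing_to_order p j" "g \<in> vanishing_to_order p k"
  shows "f * g \<in> vanishing_to_order p (j + k)"
  unfolding vanishing_to_order_def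
proof (intro CollectI allI)
  fix v
  obtain q r where "\<forall>t. f (\<lambda>i. p i + t * v i) = t ^ j * poly q t" "\<forall>t. g (\<lambda>i. p i + t * v i) = t ^ k * poly r t"
    using assms unfolding vanishing_to_order_def by blast
  then show "\<exists>q. \<forall>t. (f * g) (\<lambda>i. p i + t * v i) = t ^ (j + k) * poly q t"
    by (intro exI[of _ "q * r"]) (simp add: power_add)
qed

lemma vanishing_to_order_0: "0 \<in> vanishing_to_order p j"
  unfolding vanishing_to_order_def by (auto intro!: exI[of _ 0])

lemma poly_functions_vanishing_to_order_0:
  assumes "f \<in> poly_functions I"
  shows "f \<in> vanishing_to_order p 0"
  using assms
proof induction
  case (const c)
  show ?case unfolding vanishing_to_order_def by (auto intro!: exI[of _ "[:c:]"])
next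
  case (coord i)
  show ?case unfolding vanishing_to_order_def
  proof (intro CollectI allI)
    fix v :: "'a \<Rightarrow> complex"
    show "\<exists>q. \<forall>t. p i + t * v i = t ^ 0 * poly q t"
      by (intro exI[of _ "[:p i, v i:]"]) simp
  qed
next
  case (add f g)
  then show ?case using vanishing_to_order_add[of f p 0 g] by (simp add: plus_fun_def)
next
  case (mult f g)
  then show ?case using vanishing_to_order_mult[of f p 0 g 0] by (simp add: times_fun_def)
qed

lemma vanishing_to_order_scale:
  "f \<in> vanishing_to_order p j \<Longrightarrow> (\<lambda>x. c * f x) \<in> vanishing_to_order p j"
  using vanishing_to_order_mult[OF poly_functions_vanishing_to_order_0[OF poly_functions.const[of c UNIV]], of f p j]
  by (simp add: times_fun_def)

lemma vanishing_to_order_sum: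
  assumes "\<And>a. a \<in> A \<Longrightarrow> f a \<in> vanishing_to_order p j"
  shows "(\<Sum>a\<in>A. f a) \<in> vanishing_to_order p j"
  using assms
  by (induction A rule: infinite_finite_induct) (auto intro: vanishing_to_order_add vanishing_to_order_0)

text \<open>Along every line the constant term is \<open>f p\<close>, so a factor \<open>t\<close>
  splits off.\<close>

lemma poly_functions_vanishing_to_order_1:
  assumes "f \<in> poly_functions I" "f p = 0"
  shows "f \<in> vanishing_to_order p 1"
  unfolding vanishing_to_order_def
proof (intro CollectI allI)
  fix v
  obtain q where q: "\<forall>t. f (\<lambda>i. p i + t * v i) = poly q t"
    using poly_functions_vanishing_to_order_0[OF assms(1), of p] unfolding vanishing_to_order_def by auto
  have "poly q 0 = 0" using q[rule_format, of 0] assms(2) by simp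
  then obtain r where "q = [:0, 1:] * r" using poly_eq_0_iff_dvd[of q 0] by (auto elim: dvdE)
  then show "\<exists>q. \<forall>t. f (\<lambda>i. p i + t * v i) = t ^ 1 * poly q t" using q by (intro exI[of _ r]) simp
qed

section \<open>Generators of the local ring modulo an order of vanishing\<close>

definition span_modulo_order ::
    "'b set \<Rightarrow> ('b \<Rightarrow> ('i \<Rightarrow> complex) \<Rightarrow> complex) \<Rightarrow> ('i \<Rightarrow> complex) \<Rightarrow> nat \<Rightarrow> (('i \<Rightarrow> complex) \<Rightarrow> complex) set" where
  "span_modulo_order B w p j = {h. \<exists>c. h - (\<lambda>x. \<Sum>b\<in>B. c b * w b x) \<in> vanishing_to_order p j}"

lemma span_modulo_order_add:
  assumes "f \<in> span_modulo_order B w p j" "g \<in> span_modulo_order B w p j"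
  shows "f + g \<in> span_modulo_order B w p j"
proof -
  obtain c d where "f - (\<lambda>x. \<Sum>b\<in>B. c b * w b x) \<in> vanishing_to_order p j"
    "g - (\<lambda>x. \<Sum>b\<in>B. d b * w b x) \<in> vanishing_to_order p j"
    using assms unfolding span_modulo_order_def by blast
  from vanishing_to_order_add[OF this]
  have "f + g - (\<lambda>x. \<Sum>b\<in>B. (c b + d b) * w b x) \<in> vanishing_to_order p j"
    by (simp add: fun_diff_def plus_fun_def distrib_right sum.distrib algebra_simps)
  then show ?thesis unfolding span_modulo_order_def by (intro CollectI exI)
qed

lemma span_modulo_order_scale:
  assumes "f \<in> span_modulo_order B w p j"
  shows "(\<lambda>x. a * f x) \<in> span_modulo_order B w p j"
proof -
  obtain c where "f - (\<lambda>x. \<Sum>b\<in>B. c b * w b x) \<in> vanishing_to_order p j"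
    using assms unfolding span_modulo_order_def by blast
  from vanishing_to_order_scale[OF this, of a]
  have "(\<lambda>x. a * f x) - (\<lambda>x. \<Sum>b\<in>B. (a * c b) * w b x) \<in> vanishing_to_order p j"
    by (simp add: fun_diff_def right_diff_distrib sum_distrib_left mult.assoc)
  then show ?thesis unfolding span_modulo_order_def by (intro CollectI exI)
qed

lemma span_modulo_order_vanishing:
  assumes "f \<in> vanishing_to_order p j"
  shows "f \<in> span_modulo_order B w p j"
  unfolding span_modulo_order_def using assms
  by (intro CollectI exI[of _ "\<lambda>_. 0"]) (simp add: fun_diff_def)

lemma span_modulo_order_base:
  assumes "finite B" "b \<in> B"
  shows "w b \<in> span_modulo_order B w p j"
proof -
  have "(\<Sum>b'\<in>B. (if b' = b then 1 else 0) * w b' x) = w b x" for x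
  proof -
    have "(\<Sum>b'\<in>B. (if b' = b then 1 else 0) * w b' x) = (\<Sum>b'\<in>B. if b' = b then w b' x else 0)"
      by (intro sum.cong) auto
    then show ?thesis using assms by (simp add: sum.delta)
  qed
  then show ?thesis unfolding span_modulo_order_def
    by (intro CollectI exI[of _ "\<lambda>b'. if b' = b then 1 else 0"])
      (use vanishing_to_order_0[of p j] in \<open>simp add: fun_diff_def zero_fun_def\<close>)
qed

lemma span_modulo_order_sum:
  assumes "\<And>a. a \<in> A \<Longrightarrow> f a \<in> span_modulo_order B w p j"
  shows "(\<Sum>a\<in>A. f a) \<in> span_modulo_order B w p j"
  using assms
  by (induction A rule: infinite_finite_induct)
    (auto intro: span_modulo_order_add span_modulo_order_vanishing[OF vanishing_to_order_0])

text \<open>A monomial with some exponent at least \<open>K\<close> contains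
  \<open>(x i - p i) ^ K\<close>, which the factor \<open>g ^ K\<close> moves into the ideal. Only
  the monomials of the box of side \<open>K\<close> remain.\<close>

lemma reduce_modulo_ideal:
  assumes fin: "finite I" "finite F" and F: "F \<subseteq> poly_functions I" and g: "g \<in> poly_functions I"
    and K: "\<And>i. i \<in> I \<Longrightarrow> (g * (\<lambda>x. x i - p i)) ^ K \<in> ideal_span (poly_functions I) F"
    and r: "r \<in> poly_functions I"
  obtains t u where "t \<in> monomial_span I p K" "\<And>f. u f \<in> poly_functions I"
    "g ^ K * r = g ^ K * t + (\<Sum>f\<in>F. u f * f)"
proof -
  let ?R = "poly_functions I"
  note R = subring_carrier_poly_functions[of I]
  obtain j where "r \<in> monomial_span I p j" using poly_functions_monomial_span[OF fin(1) r] by blast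
  then obtain c where c: "r = (\<lambda>x. \<Sum>\<alpha>\<in>I \<rightarrow>\<^sub>E {..<j}. c \<alpha> * shifted_monomial I p \<alpha> x)"
    unfolding monomial_span_def by blast
  let ?E = "I \<rightarrow>\<^sub>E {..<j}" and ?EK = "I \<rightarrow>\<^sub>E {..<K}"
  let ?m = "shifted_monomial I p"
  define t where "t = (\<lambda>x. \<Sum>\<alpha>\<in>?E \<inter> ?EK. c \<alpha> * ?m \<alpha> x)"
  have "t \<in> monomial_span I p K" unfolding t_def
    by (intro monomial_span_sum monomial_span_base[OF fin(1)]) auto
  have high: "g ^ K * ?m \<alpha> \<in> ideal_span ?R F" if \<alpha>: "\<alpha> \<in> ?E - ?EK" for \<alpha>
  proof -
    obtain i where i: "i \<in> I" "K \<le> \<alpha> i" using \<alpha> by (auto simp: PiE_iff)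
    have "?m \<alpha> x = (x i - p i) ^ K * ?m (\<alpha>(i := \<alpha> i - K)) x" for x
    proof -
      have "?m \<alpha> x = (x i - p i) ^ \<alpha> i * (\<Prod>k\<in>I - {i}. (x k - p k) ^ \<alpha> k)"
        unfolding shifted_monomial_def using fin(1) i by (simp add: prod.remove)
      moreover have "?m (\<alpha>(i := \<alpha> i - K)) x = (x i - p i) ^ (\<alpha> i - K) * (\<Prod>k\<in>I - {i}. (x k - p k) ^ \<alpha> k)"
        unfolding shifted_monomial_def using fin(1) i by (simp add: prod.remove)
      moreover have "(x i - p i) ^ \<alpha> i = (x i - p i) ^ K * (x i - p i) ^ (\<alpha> i - K)"
        using i by (simp add: power_add[symmetric])
      ultimately show ?thesis by simp
    qed
    then have "g ^ K * ?m \<alpha> = ?m (\<alpha>(i := \<alpha> i - K)) * (g * (\<lambda>x. x i - p i)) ^ K"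
      by (simp add: fun_eq_iff power_fun_apply power_mult_distrib)
    then show ?thesis using ideal_span_mult[OF R shifted_monomial_poly K[OF i(1)]] by simp
  qed
  have "(\<Sum>\<alpha>\<in>?E - ?EK. (\<lambda>x. c \<alpha>) * (g ^ K * ?m \<alpha>)) \<in> ideal_span ?R F"
    by (intro ideal_span_sum ideal_span_mult[OF R poly_functions.const] high)
  from ideal_span_finite[OF R fin(2) this] obtain u where u: "\<And>f. u f \<in> ?R"
    "(\<Sum>\<alpha>\<in>?E - ?EK. (\<lambda>x. c \<alpha>) * (g ^ K * ?m \<alpha>)) = (\<Sum>f\<in>F. u f * f)"
    by blast
  have "r x = t x + (\<Sum>\<alpha>\<in>?E - ?EK. c \<alpha> * ?m \<alpha> x)" for x
    unfolding c t_def using sum.Int_Diff[OF finite_exponents[OF fin(1), of j], of _ ?EK] by blast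
  then have "g ^ K * r = g ^ K * t + (\<Sum>\<alpha>\<in>?E - ?EK. (\<lambda>x. c \<alpha>) * (g ^ K * ?m \<alpha>))"
    by (simp add: fun_eq_iff sum_fun_apply distrib_left sum_distrib_left mult_ac)
  then show ?thesis unfolding u(2) by (rule that[OF \<open>t \<in> monomial_span I p K\<close> u(1)])
qed

text \<open>Each round spends a factor \<open>g ^ K\<close> and turns \<open>r\<close> into box
  monomials plus a combination of \<open>F\<close>, whose coefficients are treated likewise with one
  order less. After \<open>j\<close> rounds only products of fewer than \<open>j\<close> factors
  from \<open>F\<close> with a box monomial remain. The exponent of \<open>g\<close> in
  \<open>w\<close> accounts for the rounds not spent on such factors. What matters is the number of
  generators, of order \<open>j\<close> to the power \<open>card F\<close>.\<close>

lemma power_mult_in_span_modulo_order: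
  fixes F :: "(('i \<Rightarrow> complex) \<Rightarrow> complex) set"
  defines "B \<equiv> \<lambda>j. {\<beta> \<in> F \<rightarrow>\<^sub>E {..<j}. sum \<beta> F < j}"
    and "w \<equiv> \<lambda>I p g K j (\<beta>, \<alpha>). g ^ (K * (j - sum \<beta> F)) * (\<Prod>f\<in>F. f ^ \<beta> f) * shifted_monomial I p \<alpha>"
  assumes fin: "finite I" "finite F" and F: "F \<subseteq> poly_functions I" and g: "g \<in> poly_functions I"
    and p: "\<And>f. f \<in> F \<Longrightarrow> f p = 0"
    and K: "\<And>i. i \<in> I \<Longrightarrow> (g * (\<lambda>x. x i - p i)) ^ K \<in> ideal_span (poly_functions I) F"
    and r: "r \<in> poly_functions I"
  shows "g ^ (K * j) * r \<in> span_modulo_order (B j \<times> (I \<rightarrow>\<^sub>E {..<K})) (w I p g K j) p j"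
  using r
proof (induction j arbitrary: r)
  case 0
  then show ?case by (intro span_modulo_order_vanishing) (simp add: poly_functions_vanishing_to_order_0)
next
  case (Suc j)
  let ?R = "poly_functions I" and ?EK = "I \<rightarrow>\<^sub>E {..<K}" and ?w = "w I p g K"
  let ?W = "\<lambda>j. span_modulo_order (B j \<times> ?EK) (?w j) p j"
  have finB: "finite (B j \<times> ?EK)" for j
    unfolding B_def using fin finite_exponents[OF fin(2), of j] finite_exponents[OF fin(1), of K] by simp
  \<comment> \<open>Multiplication by \<open>f\<close> raises both \<open>\<beta> f\<close> and
    \<open>j\<close>, so the power of \<open>g\<close> in \<open>w\<close> is unchanged, and the
    error gains one order because \<open>f p = 0\<close>.\<close>
  have step: "f * h \<in> ?W (Suc j)" if f: "f \<in> F" and h: "h \<in> ?W j" for f h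
  proof -
    obtain c where c: "h - (\<lambda>x. \<Sum>b\<in>B j \<times> ?EK. c b * ?w j b x) \<in> vanishing_to_order p j"
      using h unfolding span_modulo_order_def by blast
    have "f * (h - (\<lambda>x. \<Sum>b\<in>B j \<times> ?EK. c b * ?w j b x)) \<in> vanishing_to_order p (1 + j)"
      using f F p by (intro vanishing_to_order_mult[OF poly_functions_vanishing_to_order_1 c]) auto
    then have 1: "f * (h - (\<lambda>x. \<Sum>b\<in>B j \<times> ?EK. c b * ?w j b x)) \<in> ?W (Suc j)"
      by (intro span_modulo_order_vanishing) simp
    have 2: "f * ?w j b \<in> ?W (Suc j)" if b: "b \<in> B j \<times> ?EK" for b
    proof -
      obtain \<beta> \<alpha> where b_eq: "b = (\<beta>, \<alpha>)" by (cases b)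
      have \<beta>: "\<beta> \<in> F \<rightarrow>\<^sub>E {..<j}" "sum \<beta> F < j" and \<alpha>: "\<alpha> \<in> ?EK" using b b_eq by (auto simp: B_def)
      let ?\<beta> = "\<beta>(f := Suc (\<beta> f))"
      have "sum ?\<beta> F = Suc (\<beta> f) + sum \<beta> (F - {f})"
        using f fin(2) by (simp add: sum.remove)
      then have s: "sum ?\<beta> F = Suc (sum \<beta> F)" using f fin(2) by (simp add: sum.remove)
      have "?\<beta> \<in> F \<rightarrow>\<^sub>E {..<Suc j}" using \<beta>(1) f by (auto simp: PiE_iff extensional_def less_Suc_eq)
      then have "?\<beta> \<in> B (Suc j)" unfolding B_def using s \<beta>(2) by simp
      moreover have "(\<Prod>h\<in>F. h ^ ?\<beta> h) = f * (\<Prod>h\<in>F. h ^ \<beta> h)"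
        using f fin(2) by (simp add: prod.remove[of F f] mult.assoc)
      then have "f * ?w j b = ?w (Suc j) (?\<beta>, \<alpha>)"
        unfolding w_def b_eq prod.case s diff_Suc_Suc by (simp only: mult_ac)
      moreover have "?w (Suc j) (?\<beta>, \<alpha>) \<in> ?W (Suc j)"
        by (rule span_modulo_order_base[OF finB SigmaI[OF calculation(1) \<alpha>]])
      ultimately show ?thesis by (simp only:)
    qed
    have "(\<Sum>b\<in>B j \<times> ?EK. (\<lambda>x. c b * (f * ?w j b) x)) \<in> ?W (Suc j)"
      by (intro span_modulo_order_sum span_modulo_order_scale 2)
    from span_modulo_order_add[OF 1 this] show ?thesis
      by (simp add: fun_diff_def plus_fun_def times_fun_def sum_fun_apply right_diff_distrib sum_distrib_left mult_ac)
  qed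
  obtain t u where t: "t \<in> monomial_span I p K" and u: "\<And>f. u f \<in> ?R"
    and eq: "g ^ K * r = g ^ K * t + (\<Sum>f\<in>F. u f * f)"
    using reduce_modulo_ideal[OF fin F g K Suc.prems] by blast
  obtain c where c: "t = (\<lambda>x. \<Sum>\<alpha>\<in>?EK. c \<alpha> * shifted_monomial I p \<alpha> x)"
    using t unfolding monomial_span_def by blast
  have low: "g ^ (K * Suc j) * shifted_monomial I p \<alpha> \<in> ?W (Suc j)" if "\<alpha> \<in> ?EK" for \<alpha>
  proof -
    let ?\<beta> = "\<lambda>f\<in>F. 0::nat"
    have "?\<beta> \<in> B (Suc j)" unfolding B_def by auto
    moreover have "?w (Suc j) (?\<beta>, \<alpha>) = g ^ (K * Suc j) * shifted_monomial I p \<alpha>"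
      unfolding w_def by simp
    moreover have "?w (Suc j) (?\<beta>, \<alpha>) \<in> ?W (Suc j)"
      by (rule span_modulo_order_base[OF finB SigmaI[OF calculation(1) that]])
    ultimately show ?thesis by (simp only:)
  qed
  have "(\<Sum>\<alpha>\<in>?EK. (\<lambda>x. c \<alpha> * (g ^ (K * Suc j) * shifted_monomial I p \<alpha>) x)) \<in> ?W (Suc j)"
    by (intro span_modulo_order_sum span_modulo_order_scale low)
  moreover have "(\<Sum>\<alpha>\<in>?EK. (\<lambda>x. c \<alpha> * (g ^ (K * Suc j) * shifted_monomial I p \<alpha>) x)) = g ^ (K * Suc j) * t"
    unfolding c by (simp add: fun_eq_iff sum_fun_apply sum_distrib_left mult_ac)
  ultimately have "g ^ (K * Suc j) * t \<in> ?W (Suc j)" by metis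
  moreover have "(\<Sum>f\<in>F. f * (g ^ (K * j) * u f)) \<in> ?W (Suc j)"
    by (intro span_modulo_order_sum step Suc.IH u)
  ultimately have "g ^ (K * Suc j) * t + (\<Sum>f\<in>F. f * (g ^ (K * j) * u f)) \<in> ?W (Suc j)"
    by (rule span_modulo_order_add)
  also have "g ^ (K * Suc j) * t + (\<Sum>f\<in>F. f * (g ^ (K * j) * u f)) = g ^ (K * j) * (g ^ K * r)"
    unfolding eq mult_Suc_right power_add distrib_left sum_distrib_left by (simp only: mult_ac)
  also have "\<dots> = g ^ (K * Suc j) * r"
    unfolding mult_Suc_right power_add by (simp only: mult_ac)
  finally show ?case .
qed

text \<open>
  By the Nullstellensatz the local ring at an isolated zero \<open>p\<close> of \<open>f\<^sub>1, \<dots>, f\<^sub>s\<close> is, modulo the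
  \<open>j\<close>-th power of its maximal ideal, spanned by \<open>O(j\<^sup>s)\<close> elements, whereas the monomials of degree below
  \<open>j\<close> in \<open>m\<close> variables are independent there and number about \<open>j\<^sup>m\<close>. Order of vanishing is
  measured along lines through \<open>p\<close>.
\<close>

theorem isolated_zero_card:
  assumes fin: "finite I" "finite F" and F: "F \<subseteq> poly_functions I"
    and p: "p \<in> zero_set I F" and g: "g \<in> poly_functions I" "g p \<noteq> 0"
    and isolated: "\<And>x. x \<in> zero_set I F \<Longrightarrow> g x \<noteq> 0 \<Longrightarrow> x = p"
  shows "card I \<le> card F"
proof (rule ccontr)
  assume "\<not> card I \<le> card F"
  then have less: "card F < card I" by simp
  let ?R = "poly_functions I"
  note R = subring_carrier_poly_functions[of I]
  \<comment> \<open>On the zero set of \<open>F\<close> either \<open>g\<close> vanishes or the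
    point is \<open>p\<close>, so the product vanishes everywhere on it.\<close>
  have "\<exists>k. (g * (\<lambda>x. x i - p i)) ^ k \<in> ideal_span ?R F" if i: "i \<in> I" for i
  proof -
    have "(g * (\<lambda>x. x i - p i)) x = 0" if "x \<in> zero_set I F" for x
      using isolated[OF that] by auto
    moreover have "g * (\<lambda>x. x i - p i) \<in> ?R" using g(1) coordinate_difference_poly[OF i] by (rule poly_functions_intros)
    ultimately show ?thesis using nullstellensatz[OF fin(1) F] by metis
  qed
  then obtain k where k: "\<And>i. i \<in> I \<Longrightarrow> (g * (\<lambda>x. x i - p i)) ^ k i \<in> ideal_span ?R F" by metis
  define K where "K = sum k I"
  have K: "(g * (\<lambda>x. x i - p i)) ^ K \<in> ideal_span ?R F" if i: "i \<in> I" for i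
  proof -
    have "k i \<le> K" unfolding K_def using fin(1) i by (simp add: member_le_sum)
    then have "(g * (\<lambda>x. x i - p i)) ^ K = (g * (\<lambda>x. x i - p i)) ^ (K - k i) * (g * (\<lambda>x. x i - p i)) ^ k i"
      by (simp add: power_add[symmetric])
    also have "\<dots> \<in> ideal_span ?R F"
      using g(1) coordinate_difference_poly[OF i] by (intro ideal_span_mult[OF R _ k[OF i]] poly_functions_intros)
    finally show ?thesis .
  qed
  define m where "m = card I"
  define s where "s = card F"
  \<comment> \<open>The choice of \<open>a\<close> makes \<open>(m * a) ^ s * K ^ m\<close>, which
    bounds the number of generators, smaller than \<open>a ^ Suc s\<close> and hence than
    \<open>a ^ m\<close>. The choice \<open>j = m * a\<close> exceeds the total degree
    \<open>m * (a - 1)\<close> of the monomials in the box of side \<open>a\<close>.\<close>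
  define a where "a = Suc (m ^ s * K ^ m)"
  define j where "j = m * a"
  let ?EK = "I \<rightarrow>\<^sub>E {..<K}" and ?E = "I \<rightarrow>\<^sub>E {..<a}"
  define A where "A = {\<beta> \<in> F \<rightarrow>\<^sub>E {..<j}. sum \<beta> F < j} \<times> ?EK"
  have finA: "finite A" unfolding A_def
    using finite_exponents[OF fin(2), of j] finite_exponents[OF fin(1), of K] by simp
  have "card A \<le> card ((F \<rightarrow>\<^sub>E {..<j}) \<times> ?EK)"
    unfolding A_def 
    using finite_exponents[OF fin(2), of j] finite_exponents[OF fin(1), of K]
    by (intro card_mono) auto
  also have "\<dots> = a ^ s * (m ^ s * K ^ m)"
    using fin by (simp add: card_cartesian_product card_PiE j_def power_mult_distrib m_def s_def)
  also have "\<dots> < a ^ s * a" by (simp add: a_def)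
  also have "\<dots> \<le> a ^ m"
    using power_increasing[of "Suc s" m a] less by (simp add: m_def s_def a_def mult.commute)
  also have "\<dots> = card ?E" using fin by (simp add: card_PiE m_def)
  finally have card: "card A < card ?E" .
  have p0: "f p = 0" if "f \<in> F" for f using p that by (auto simp: zero_set_def)
  have "\<exists>w. \<forall>\<alpha>. g ^ (K * j) * shifted_monomial I p \<alpha> \<in> span_modulo_order A w p j"
    unfolding A_def
    by (rule exI, rule allI, rule power_mult_in_span_modulo_order)
      (simp_all add: fin F g p0 K shifted_monomial_poly)
  then obtain w where "\<forall>\<alpha>. \<exists>c. g ^ (K * j) * shifted_monomial I p \<alpha> - (\<lambda>x. \<Sum>b\<in>A. c b * w b x)
      \<in> vanishing_to_order p j"
    unfolding span_modulo_order_def mem_Collect_eq by (rule exE)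
  from choice[OF this] obtain c where
    w: "g ^ (K * j) * shifted_monomial I p \<alpha> - (\<lambda>x. \<Sum>b\<in>A. c \<alpha> b * w b x) \<in> vanishing_to_order p j" for \<alpha>
    by blast
  \<comment> \<open>There are more monomials than generators, so some nonzero combination
    \<open>r\<close> loses all its generator terms: \<open>g ^ (K * j) * r\<close> vanishes to order
    \<open>j\<close> although \<open>r\<close> has degree below \<open>j\<close>.\<close>
  obtain e where e: "\<exists>\<alpha>\<in>?E. e \<alpha> \<noteq> 0" "\<And>b. b \<in> A \<Longrightarrow> (\<Sum>\<alpha>\<in>?E. e \<alpha> * c \<alpha> b) = 0"
    using underdetermined_system[OF finA finite_exponents[OF fin(1)] card, of "\<lambda>b \<alpha>. c \<alpha> b"] by blast
  define r where "r = (\<lambda>x. \<Sum>\<alpha>\<in>?E. e \<alpha> * shifted_monomial I p \<alpha> x)"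
  have "(\<Sum>\<alpha>\<in>?E. (\<lambda>x. e \<alpha> * (g ^ (K * j) * shifted_monomial I p \<alpha> - (\<lambda>x. \<Sum>b\<in>A. c \<alpha> b * w b x)) x))
      \<in> vanishing_to_order p j"
    by (intro vanishing_to_order_sum vanishing_to_order_scale w)
  also have "(\<Sum>\<alpha>\<in>?E. (\<lambda>x. e \<alpha> * (g ^ (K * j) * shifted_monomial I p \<alpha> - (\<lambda>x. \<Sum>b\<in>A. c \<alpha> b * w b x)) x))
      = g ^ (K * j) * r"
  proof
    fix x
    have "(\<Sum>\<alpha>\<in>?E. e \<alpha> * (\<Sum>b\<in>A. c \<alpha> b * w b x)) = (\<Sum>b\<in>A. (\<Sum>\<alpha>\<in>?E. e \<alpha> * c \<alpha> b) * w b x)"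
      unfolding sum_distrib_left sum_distrib_right by (subst sum.swap) (simp add: mult.assoc)
    also have "\<dots> = 0" using e(2) by simp
    finally show "(\<Sum>\<alpha>\<in>?E. (\<lambda>x. e \<alpha> * (g ^ (K * j) * shifted_monomial I p \<alpha> - (\<lambda>x. \<Sum>b\<in>A. c \<alpha> b * w b x)) x)) x
      = (g ^ (K * j) * r) x"
      by (simp add: sum_fun_apply r_def right_diff_distrib sum_subtractf sum_distrib_left mult_ac)
  qed
  finally have vanish: "g ^ (K * j) * r \<in> vanishing_to_order p j" .
  obtain x where x: "r x \<noteq> 0"
    using shifted_monomials_independent[OF fin(1)] e(1) unfolding r_def by metis
  \<comment> \<open>The line from \<open>p\<close> through a point \<open>x\<close> with
    \<open>r x\<close> nonzero; \<open>\<rho>\<close> is the restriction of \<open>r\<close> to it,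
    with \<open>x\<close> at parameter \<open>1\<close>.\<close>
  define v where "v = (\<lambda>i. x i - p i)"
  define \<rho> where "\<rho> = (\<Sum>\<alpha>\<in>?E. monom (e \<alpha> * (\<Prod>i\<in>I. v i ^ \<alpha> i)) (sum \<alpha> I))"
  have \<rho>: "poly \<rho> t = r (\<lambda>i. p i + t * v i)" for t
    unfolding \<rho>_def r_def poly_sum poly_monom shifted_monomial_def
    by (simp add: power_mult_distrib prod.distrib power_sum mult_ac)
  have "poly \<rho> 1 \<noteq> 0" unfolding \<rho> using x by (simp add: v_def)
  then have "\<rho> \<noteq> 0" by auto
  have "degree \<rho> \<le> m * (m ^ s * K ^ m)"
    unfolding \<rho>_def
  proof (rule degree_sum_le)
    show "finite ?E" by (rule finite_exponents[OF fin(1)])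
    fix \<alpha> assume "\<alpha> \<in> ?E"
    then have "sum \<alpha> I \<le> m * (m ^ s * K ^ m)"
      using sum_bounded_above[of I \<alpha> "m ^ s * K ^ m"] by (auto simp: PiE_iff a_def m_def less_Suc_eq_le)
    then show "degree (monom (e \<alpha> * (\<Prod>i\<in>I. v i ^ \<alpha> i)) (sum \<alpha> I)) \<le> m * (m ^ s * K ^ m)"
      using degree_monom_le order_trans by blast
  qed
  also have "\<dots> < j" using less by (simp add: j_def a_def m_def)
  finally have deg: "degree \<rho> < j" .
  obtain q where q: "\<And>t. (g ^ (K * j) * r) (\<lambda>i. p i + t * v i) = t ^ j * poly q t"
    using vanish unfolding vanishing_to_order_def by blast
  obtain G where G: "\<And>t. g (\<lambda>i. p i + t * v i) = poly G t"
    using poly_functions_vanishing_to_order_0[OF g(1), of p] unfolding vanishing_to_order_def by auto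
  have "poly (G ^ (K * j) * \<rho>) t = poly ([:0, 1:] ^ j * q) t" for t
    using q[of t] by (simp add: power_fun_apply G \<rho> poly_power)
  then have eq: "G ^ (K * j) * \<rho> = [:0, 1:] ^ j * q" by (simp add: poly_eq_poly_eq_iff[symmetric] fun_eq_iff)
  \<comment> \<open>The power of \<open>g\<close> is nonzero at \<open>t = 0\<close>, so the whole
    order \<open>j\<close> falls on \<open>\<rho>\<close>, exceeding its degree.\<close>
  have G0: "poly G 0 \<noteq> 0" using G[of 0] g(2) by simp
  then have nz: "G ^ (K * j) * \<rho> \<noteq> 0" using \<open>\<rho> \<noteq> 0\<close> by auto
  have "[:- 0, 1:] ^ j dvd G ^ (K * j) * \<rho>" unfolding eq by simp
  then have "j \<le> order 0 (G ^ (K * j) * \<rho>)" using nz order_divides by blast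
  also have "\<dots> = order 0 \<rho>"
    using order_mult[OF nz, of 0] G0 by (simp add: order_0I poly_power)
  also have "\<dots> \<le> degree \<rho>" by (rule order_degree[OF \<open>\<rho> \<noteq> 0\<close>])
  finally show False using deg by simp
qed

section \<open>Chains of irreducible closed sets\<close>

lemma irreducible_in_finite_Union:
  assumes "irreducible_in T Z" "finite D" "\<And>W. W \<in> D \<Longrightarrow> closedin T W" "Z \<subseteq> \<Union>D"
  obtains W where "W \<in> D" "Z \<subseteq> W"
proof -
  have "\<exists>W\<in>D. Z \<subseteq> W"
    using assms(2-4)
  proof (induction D rule: finite_induct)
    case empty
    then show ?case using assms(1) by (auto simp: irreducible_in_def)
  next
    case (insert W D)
    have "closedin T (\<Union>D)" using insert by (intro closedin_Union) auto
    then have "Z \<subseteq> W \<or> Z \<subseteq> \<Union>D"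
      using insert assms(1) unfolding irreducible_in_def by auto
    then show ?case using insert by auto
  qed
  then show ?thesis using that by blast
qed

lemma zero_set_closed: "F \<subseteq> poly_functions I \<Longrightarrow> closedin (zariski_topology I) (zero_set I F)"
  unfolding closedin_zariski by blast

lemma affine_space_ext:
  "x \<in> affine_space I \<Longrightarrow> y \<in> affine_space I \<Longrightarrow> (\<And>i. i \<in> I \<Longrightarrow> x i = y i) \<Longrightarrow> x = y"
  unfolding affine_space_def by (rule PiE_ext)

lemma singleton_closed:
  assumes "p \<in> affine_space I"
  shows "closedin (zariski_topology I) {p}"
proof -
  have "zero_set I ((\<lambda>i x. x i - p i) ` I) = {p}"
    using assms affine_space_ext[of _ I p] by (auto simp: zero_set_def)
  moreover have "(\<lambda>i x. x i - p i) ` I \<subseteq> poly_functions I"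
    by (auto intro: coordinate_difference_poly)
  ultimately show ?thesis using zero_set_closed[of "(\<lambda>i x. x i - p i) ` I" I] by simp
qed

lemma singleton_irreducible: "p \<in> affine_space I \<Longrightarrow> irreducible_in (zariski_topology I) {p}"
  by (auto simp: irreducible_in_def topspace_zariski)

text \<open>Takes the place of prime avoidance: a component is not contained in the zero set once
  one chosen point of it is avoided. A multiple of a coordinate difference separating the new point
  from \<open>p\<close> is added, and only finitely many multiples are bad.\<close>

lemma generic_function_through_point:
  assumes "finite Q" "Q \<subseteq> affine_space I" "p \<in> affine_space I" "p \<notin> Q"
  obtains f where "f \<in> poly_functions I" "f p = 0" "\<And>q. q \<in> Q \<Longrightarrow> f q \<noteq> 0"
proof -
  have "\<exists>f\<in>poly_functions I. f p = 0 \<and> (\<forall>q\<in>Q. f q \<noteq> 0)"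
    using assms
  proof (induction Q rule: finite_induct)
    case empty
    then show ?case using poly_functions.const[of 0 I] by auto
  next
    case (insert q Q)
    then obtain f where f: "f \<in> poly_functions I" "f p = 0" "\<forall>q\<in>Q. f q \<noteq> 0" by auto
    obtain i where i: "i \<in> I" "q i \<noteq> p i" using insert.prems affine_space_ext[of q I p] by auto
    let ?g = "\<lambda>x. x i - p i"
    \<comment> \<open>Where \<open>?g x = 0\<close> the quotient is \<open>0\<close> by convention.
      Such an \<open>x\<close> is one of the earlier points, where the sum is the nonzero value
      \<open>f x\<close>.\<close>
    have "finite ((\<lambda>x. - f x / ?g x) ` insert q Q)" using insert by simp
    then obtain t where t: "t \<notin> (\<lambda>x. - f x / ?g x) ` insert q Q"
      using ex_new_if_finite[OF infinite_UNIV_char_0] by blast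
    have "f x + t * ?g x \<noteq> 0" if "x \<in> insert q Q" for x
    proof
      assume eq: "f x + t * ?g x = 0"
      show False
      proof (cases "?g x = 0")
        case True
        then show False using eq f(3) i that by auto
      next
        case False
        then have "t = - f x / ?g x" using eq by (simp add: field_simps eq_neg_iff_add_eq_0)
        then show False using t that by blast
      qed
    qed
    moreover have "(\<lambda>x. f x + t * ?g x) \<in> poly_functions I"
      using i by (intro poly_functions.add poly_functions.mult poly_functions.const f coordinate_difference_poly)
    ultimately show ?case using f(2) by (intro bexI[of _ "\<lambda>x. f x + t * ?g x"]) auto
  qed
  then show ?thesis using that by blast
qed

text \<open>All members pass through \<open>p\<close>, so each of them meets every open
  neighbourhood of \<open>p\<close> and the chain can be restricted there. The length
  \<open>k\<close> counts the strict inclusions.\<close>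

definition chain_through :: "'i set \<Rightarrow> ('i \<Rightarrow> complex) \<Rightarrow> ('i \<Rightarrow> complex) set \<Rightarrow> nat \<Rightarrow> bool" where
  "chain_through I p X k \<longleftrightarrow> (\<exists>Z :: nat \<Rightarrow> ('i \<Rightarrow> complex) set.
    (\<forall>i\<le>k. closedin (zariski_topology I) (Z i) \<and> irreducible_in (zariski_topology I) (Z i) \<and> p \<in> Z i) \<and>
    (\<forall>i<k. Z i \<subset> Z (Suc i)) \<and> Z k \<subseteq> X)"

lemma chain_through_extend:
  assumes Z: "\<forall>i\<le>k. closedin (zariski_topology I) (Z i) \<and> irreducible_in (zariski_topology I) (Z i) \<and> p \<in> Z i"
      "\<forall>i<k. Z i \<subset> Z (Suc i)" "Z k \<subset> W"
    and W: "closedin (zariski_topology I) W" "irreducible_in (zariski_topology I) W" "W \<subseteq> X"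
  shows "chain_through I p X (Suc k)"
  unfolding chain_through_def
proof (intro exI[of _ "Z(Suc k := W)"] conjI allI impI)
  let ?Z = "Z(Suc k := W)"
  show "?Z (Suc k) \<subseteq> X" using W by simp
  fix i
  show "?Z i \<subset> ?Z (Suc i)" if "i < Suc k" using that Z(2,3) by (cases "i = k") auto
  assume "i \<le> Suc k"
  then show "closedin (zariski_topology I) (?Z i)" "irreducible_in (zariski_topology I) (?Z i)" "p \<in> ?Z i"
    using Z(1,3) W by (cases "i = Suc k"; auto)+
qed

text \<open>
  A function vanishing at \<open>p\<close> but identically on none of the positive-dimensional components
  through \<open>p\<close> shortens every chain by one, so after as many such cuts as the longest chain
  through \<open>p\<close> allows, \<open>p\<close> becomes isolated.
\<close>

lemma chain_through_or_isolated:
  assumes fin: "finite I" and X: "closedin (zariski_topology I) X" "p \<in> X"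
  shows "chain_through I p X (Suc k) \<or>
    (\<exists>F g. finite F \<and> card F \<le> k \<and> F \<subseteq> poly_functions I \<and> g \<in> poly_functions I \<and>
      p \<in> zero_set I F \<and> g p \<noteq> 0 \<and> (\<forall>x \<in> X \<inter> zero_set I F. g x \<noteq> 0 \<longrightarrow> x = p))"
  using X
proof (induction k arbitrary: X)
  case 0
  let ?T = "zariski_topology I"
  have p: "p \<in> affine_space I" using closedin_subset[OF "0.prems"(1)] "0.prems"(2) by (auto simp: topspace_zariski)
  obtain D where D: "finite D" "\<Union>D = X" "\<And>W. W \<in> D \<Longrightarrow> closedin ?T W \<and> irreducible_in ?T W"
    using closedin_zariski_decompose[OF fin "0.prems"(1)] by metis
  show ?case
  proof (cases "\<exists>W\<in>D. p \<in> W \<and> W \<noteq> {p}")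
    case True
    then obtain W where "W \<in> D" "p \<in> W" "W \<noteq> {p}" by blast
    then have "chain_through I p X (Suc 0)"
      using D p by (intro chain_through_extend[where Z = "\<lambda>_. {p}" and W = W])
        (auto simp: singleton_closed singleton_irreducible)
    then show ?thesis by blast
  next
    case False
    \<comment> \<open>The components missing \<open>p\<close> form a closed set; \<open>g\<close>
      vanishes on it but not at \<open>p\<close>.\<close>
    let ?U = "\<Union>{W \<in> D. p \<notin> W}"
    have "closedin ?T ?U" using D by (intro closedin_Union) auto
    then obtain G where G: "G \<subseteq> poly_functions I" "?U = zero_set I G" unfolding closedin_zariski by blast
    moreover have "p \<notin> ?U" by blast
    ultimately obtain g where g: "g \<in> G" "g p \<noteq> 0" using p unfolding zero_set_def by blast
    have "x = p" if x: "x \<in> X" "g x \<noteq> 0" for x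
    proof -
      obtain W where W: "W \<in> D" "x \<in> W" using x(1) D(2) by blast
      have "x \<notin> ?U" unfolding G(2) using g x by (auto simp: zero_set_def)
      then have "p \<in> W" using W by blast
      then show ?thesis using False W by blast
    qed
    then show ?thesis using g G p by (intro disjI2 exI[of _ "{}"] exI[of _ g]) (auto simp: zero_set_def)
  qed
next
  case (Suc k)
  let ?T = "zariski_topology I"
  have sub: "X \<subseteq> affine_space I" using closedin_subset[OF Suc.prems(1)] by (simp add: topspace_zariski)
  then have p: "p \<in> affine_space I" using Suc.prems by blast
  obtain D where D: "finite D" "\<Union>D = X" "\<And>W. W \<in> D \<Longrightarrow> closedin ?T W \<and> irreducible_in ?T W"
    using closedin_zariski_decompose[OF fin Suc.prems(1)] by metis
  let ?D = "{W \<in> D. p \<in> W \<and> W \<noteq> {p}}"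
  \<comment> \<open>A second point on every component through \<open>p\<close> other than
    \<open>{p}\<close>; where \<open>f\<close> is nonzero at it, \<open>f\<close> does not vanish on
    the component.\<close>
  define q where "q W = (SOME q. q \<in> W \<and> q \<noteq> p)" for W
  have q: "q W \<in> W \<and> q W \<noteq> p" if "W \<in> ?D" for W
  proof -
    have "\<exists>q. q \<in> W \<and> q \<noteq> p" using that by auto
    from someI_ex[OF this] show ?thesis unfolding q_def .
  qed
  obtain f where f: "f \<in> poly_functions I" "f p = 0" "\<And>W. W \<in> ?D \<Longrightarrow> f (q W) \<noteq> 0"
  proof (rule generic_function_through_point[of "q ` ?D" I p])
    show "finite (q ` ?D)" using D by simp
    show "q ` ?D \<subseteq> affine_space I" using q D(2) sub by blast
    show "p \<notin> q ` ?D" using q by blast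
  qed (use p that in auto)
  let ?X = "X \<inter> zero_set I {f}"
  have "closedin ?T ?X" using Suc.prems f by (intro closedin_Int zero_set_closed) auto
  moreover have "p \<in> ?X" using Suc.prems f p by (auto simp: zero_set_def)
  ultimately consider "chain_through I p ?X (Suc k)" |
    F g where "finite F" "card F \<le> k" "F \<subseteq> poly_functions I" "g \<in> poly_functions I"
      "p \<in> zero_set I F" "g p \<noteq> 0" "\<forall>x \<in> ?X \<inter> zero_set I F. g x \<noteq> 0 \<longrightarrow> x = p"
    using Suc.IH[of ?X] by blast
  then show ?case
  proof cases
    case 1
    then obtain Z where Z: "\<forall>i\<le>Suc k. closedin ?T (Z i) \<and> irreducible_in ?T (Z i) \<and> p \<in> Z i"
      "\<forall>i<Suc k. Z i \<subset> Z (Suc i)" "Z (Suc k) \<subseteq> ?X" unfolding chain_through_def by blast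
    \<comment> \<open>The top of the chain for \<open>?X\<close> lies in a component
      \<open>W\<close> of \<open>X\<close>. It contains a further member of the chain strictly, so
      \<open>W\<close> is not \<open>{p}\<close>; as \<open>f\<close> vanishes on the top but not at
      \<open>q W\<close>, \<open>W\<close> extends the chain.\<close>
    obtain W where W: "W \<in> D" "Z (Suc k) \<subseteq> W"
      using irreducible_in_finite_Union[of ?T "Z (Suc k)" D] D Z by blast
    have "Z k \<subset> Z (Suc k)" "p \<in> Z k" using Z by auto
    then have "W \<in> ?D" using W by blast
    then have "q W \<notin> Z (Suc k)" "q W \<in> W" using f(3) q Z(3) by (auto simp: zero_set_def)
    then have "Z (Suc k) \<subset> W" using W by blast
    then have "chain_through I p X (Suc (Suc k))"
      using Z D W by (intro chain_through_extend[where Z = Z and W = W]) auto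
    then show ?thesis by blast
  next
    case 2
    have "card (insert f F) \<le> Suc k" using 2 card_insert_le_m1[of "Suc k" F f] by simp
    moreover have "X \<inter> zero_set I (insert f F) = ?X \<inter> zero_set I F" by (auto simp: zero_set_def)
    moreover have "p \<in> zero_set I (insert f F)" using 2 f by (auto simp: zero_set_def)
    ultimately show ?thesis using 2 f by (intro disjI2 exI[of _ "insert f F"] exI[of _ g]) simp
  qed
qed

text \<open>A geometric form of Krull's height theorem. Without the chain, \<open>k - 1\<close>
  further functions would isolate \<open>p\<close>, fewer than \<open>card I\<close> functions in
  all. The subtraction truncates, and for \<open>k = 0\<close> the chain is just
  \<open>{p}\<close>.\<close>

theorem chain_through_zero_set:
  assumes fin: "finite I" "finite F" and F: "F \<subseteq> poly_functions I" and p: "p \<in> zero_set I F"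
    and k: "k \<le> card I - card F"
  shows "chain_through I p (zero_set I F) k"
proof (cases k)
  case 0
  have "p \<in> affine_space I" using p by (simp add: zero_set_def)
  then show ?thesis unfolding 0 chain_through_def using p
    by (intro exI[of _ "\<lambda>_. {p}"]) (simp add: singleton_closed singleton_irreducible)
next
  case (Suc k')
  from chain_through_or_isolated[OF fin(1) zero_set_closed[OF F] p, of k'] show ?thesis
  proof (elim disjE exE conjE)
    fix G g
    assume G: "finite G" "card G \<le> k'" "G \<subseteq> poly_functions I" "g \<in> poly_functions I"
      "p \<in> zero_set I G" "g p \<noteq> 0" "\<forall>x \<in> zero_set I F \<inter> zero_set I G. g x \<noteq> 0 \<longrightarrow> x = p"
    have eq: "zero_set I (F \<union> G) = zero_set I F \<inter> zero_set I G" by (auto simp: zero_set_def)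
    have "card I \<le> card (F \<union> G)"
    proof (rule isolated_zero_card)
      show "x = p" if "x \<in> zero_set I (F \<union> G)" "g x \<noteq> 0" for x using that G(7) eq by blast
    qed (use fin F p G(1,3-6) eq in simp_all)
    also have "\<dots> \<le> card F + card G" by (rule card_Un_le)
    finally show ?thesis using k G(2) Suc by simp
  qed (simp add: Suc)
qed

text \<open>Each \<open>Z i\<close> is irreducible and contains \<open>p\<close>, where
  \<open>g\<close> is nonzero, so its part with \<open>g\<close> nonzero is dense in it; that part
  lies in \<open>X\<close>. Density transfers irreducibility and strict inclusions to the
  intersections with \<open>X\<close>.\<close>

lemma zariski_dim_ge_chain_length:
  assumes chain: "chain_through I p (zero_set I F) k"
    and g: "g \<in> poly_functions I" "g p \<noteq> 0"
    and X: "X \<subseteq> affine_space I" "p \<in> X" "\<And>x. x \<in> zero_set I F \<Longrightarrow> g x \<noteq> 0 \<Longrightarrow> x \<in> X"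
  shows "ereal (real k) \<le> zariski_dim I X"
proof -
  let ?T = "zariski_topology I" and ?S = "subtopology (zariski_topology I) X"
  obtain Z where Z: "\<And>i. i \<le> k \<Longrightarrow> closedin ?T (Z i) \<and> irreducible_in ?T (Z i) \<and> p \<in> Z i"
    and strict: "\<And>i. i < k \<Longrightarrow> Z i \<subset> Z (Suc i)" and ZF: "Z k \<subseteq> zero_set I F"
    using chain unfolding chain_through_def by blast
  have Zsub: "Z i \<subseteq> zero_set I F" if "i \<le> k" for i
    using that
  proof (induction rule: inc_induct)
    case (step n)
    then show ?case using strict[of n] by auto
  qed (rule ZF)
  have g_closed: "closedin ?T (zero_set I {g})" using g by (intro zero_set_closed) simp
  have dense: "Z i \<subseteq> A" if "i \<le> k" "closedin ?T A" "Z i \<inter> X \<subseteq> A" for i A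
  proof -
    have "Z i \<subseteq> A \<union> zero_set I {g}"
    proof
      fix x assume x: "x \<in> Z i"
      then have xF: "x \<in> zero_set I F" using Zsub[OF that(1)] by blast
      show "x \<in> A \<union> zero_set I {g}"
      proof (cases "g x = 0")
        case True
        then show ?thesis using xF by (simp add: zero_set_def)
      next
        case False
        then show ?thesis using X(3)[OF xF] x that(3) by blast
      qed
    qed
    moreover have "\<not> Z i \<subseteq> zero_set I {g}" using Z[OF that(1)] g by (auto simp: zero_set_def)
    ultimately show ?thesis using Z[OF that(1)] that(2) g_closed unfolding irreducible_in_def by blast
  qed
  have "closedin ?S (Z i \<inter> X) \<and> irreducible_in ?S (Z i \<inter> X)" if i: "i \<le> k" for i
  proof
    show "closedin ?S (Z i \<inter> X)" using Z[OF i] by (auto simp: closedin_subtopology)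
    show "irreducible_in ?S (Z i \<inter> X)" unfolding irreducible_in_def
    proof (intro conjI allI impI)
      show "Z i \<inter> X \<subseteq> topspace ?S" using X(1) by (auto simp: topspace_zariski)
      show "Z i \<inter> X \<noteq> {}" using Z[OF i] X(2) by blast
      fix A B assume "closedin ?S A \<and> closedin ?S B \<and> Z i \<inter> X \<subseteq> A \<union> B"
      then obtain A' B' where AB: "closedin ?T A'" "A = A' \<inter> X" "closedin ?T B'" "B = B' \<inter> X"
        "Z i \<inter> X \<subseteq> A' \<union> B'" by (auto simp: closedin_subtopology)
      then have "Z i \<subseteq> A' \<union> B'" by (intro dense[OF i] closedin_Un)
      then have "Z i \<subseteq> A' \<or> Z i \<subseteq> B'" using Z[OF i] AB unfolding irreducible_in_def by blast
      then show "Z i \<inter> X \<subseteq> A \<or> Z i \<inter> X \<subseteq> B" using AB by blast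
    qed
  qed
  moreover have "Z i \<inter> X \<subset> Z (Suc i) \<inter> X" if "i < k" for i
  proof -
    have "\<not> Z (Suc i) \<inter> X \<subseteq> Z i" using dense[of "Suc i" "Z i"] Z[of i] strict[OF that] that by auto
    then show ?thesis using strict[OF that] by blast
  qed
  ultimately show ?thesis unfolding zariski_dim_def krull_dim_def
    by (intro Sup_upper CollectI exI[of _ k] conjI refl exI[of _ "\<lambda>i. Z i \<inter> X"]) auto
qed

section \<open>Linear dependence\<close>

lemma lin_dep_family_mono:
  assumes "lin_dep_family n \<gamma> S" "S \<subseteq> T" "finite T"
  shows "lin_dep_family n \<gamma> T"
proof -
  obtain c where c: "\<exists>i\<in>S. c i \<noteq> 0" "\<forall>k\<in>{1..n}. (\<Sum>i\<in>S. c i * \<gamma> (k, i)) = 0"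
    using assms(1) unfolding lin_dep_family_def by blast
  let ?c = "\<lambda>i. if i \<in> S then c i else 0"
  have "(\<Sum>i\<in>T. ?c i * \<gamma> (k, i)) = (\<Sum>i\<in>S. c i * \<gamma> (k, i))" for k
    using assms by (intro sum.mono_neutral_cong_right) auto
  then have "\<forall>k\<in>{1..n}. (\<Sum>i\<in>T. ?c i * \<gamma> (k, i)) = 0" using c(2) by simp
  moreover have "\<exists>i\<in>T. ?c i \<noteq> 0" using c(1) assms(2) by auto
  ultimately show ?thesis unfolding lin_dep_family_def by (intro exI[of _ ?c]) simp
qed

text \<open>The coefficients of a relation have to solve one equation for each element of
  \<open>B\<close>, with more unknowns than equations.\<close>

lemma lin_dep_family_in_span:
  assumes "finite B" "finite C" "card B < card C"
    and span: "\<And>q k. q \<in> C \<Longrightarrow> k \<in> {1..n} \<Longrightarrow> \<gamma> (k, q) = (\<Sum>b\<in>B. a q b * M k b)"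
  shows "lin_dep_family n \<gamma> C"
proof -
  obtain c where c: "\<exists>q\<in>C. c q \<noteq> 0" "\<And>b. b \<in> B \<Longrightarrow> (\<Sum>q\<in>C. c q * a q b) = 0"
    using underdetermined_system[OF assms(1-3), of "\<lambda>b q. a q b"] by blast
  have "(\<Sum>q\<in>C. c q * \<gamma> (k, q)) = 0" if "k \<in> {1..n}" for k
  proof -
    have "(\<Sum>q\<in>C. c q * \<gamma> (k, q)) = (\<Sum>q\<in>C. \<Sum>b\<in>B. c q * a q b * M k b)"
      using span that by (intro sum.cong) (auto simp: sum_distrib_left mult.assoc)
    also have "\<dots> = (\<Sum>b\<in>B. (\<Sum>q\<in>C. c q * a q b) * M k b)"
      by (subst sum.swap) (simp add: sum_distrib_right)
    also have "\<dots> = 0" using c(2) by simp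
    finally show ?thesis .
  qed
  then show ?thesis unfolding lin_dep_family_def using c(1) by blast
qed

text \<open>The standard basis serves as the smaller spanning family.\<close>

lemma lin_dep_family_card:
  assumes "finite S" "n < card S"
  shows "lin_dep_family n \<gamma> S"
proof (rule lin_dep_family_in_span[of "{1..n}" _ _ _ "\<lambda>q b. \<gamma> (b, q)" "\<lambda>k b. if k = b then 1 else 0"])
  fix q :: 'a and k :: nat assume "k \<in> {1..n}"
  have "(\<Sum>b\<in>{1..n}. \<gamma> (b, q) * (if k = b then 1 else 0)) = (\<Sum>b\<in>{1..n}. if k = b then \<gamma> (b, q) else 0)"
    by (intro sum.cong) auto
  then show "\<gamma> (k, q) = (\<Sum>b\<in>{1..n}. \<gamma> (b, q) * (if k = b then 1 else 0))"
    using \<open>k \<in> {1..n}\<close> by simp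
qed (use assms in auto)

text \<open>Since \<open>T\<close> is a basis of \<open>n\<close>-space, \<open>q\<close> has
  coordinates in it. Dependence of \<open>T - b + q\<close> makes the coordinate at \<open>b\<close>
  vanish, so only those in \<open>B\<close> are left.\<close>

lemma in_span_of_exchange:
  assumes T: "finite T" "card T = n" "\<not> lin_dep_family n \<gamma> T" and B: "B \<subseteq> T" and q: "q \<notin> T"
    and exchange: "\<And>b. b \<in> T - B \<Longrightarrow> lin_dep_family n \<gamma> (insert q (T - {b}))"
  obtains a where "\<And>k. k \<in> {1..n} \<Longrightarrow> \<gamma> (k, q) = (\<Sum>b\<in>B. a b * \<gamma> (k, b))"
proof -
  have zero: "c b = 0" if "\<forall>k\<in>{1..n}. (\<Sum>i\<in>T. c i * \<gamma> (k, i)) = 0" "b \<in> T" for c b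
    using T(3) that unfolding lin_dep_family_def by blast
  have "lin_dep_family n \<gamma> (insert q T)" using T q by (intro lin_dep_family_card) auto
  then obtain c where c: "\<exists>i\<in>insert q T. c i \<noteq> 0" "\<forall>k\<in>{1..n}. (\<Sum>i\<in>insert q T. c i * \<gamma> (k, i)) = 0"
    unfolding lin_dep_family_def by blast
  then have c_rel: "c q * \<gamma> (k, q) + (\<Sum>i\<in>T. c i * \<gamma> (k, i)) = 0" if "k \<in> {1..n}" for k
    using that T q by simp
  have cq: "c q \<noteq> 0"
  proof
    assume "c q = 0"
    then have "c b = 0" if "b \<in> T" for b using c_rel zero[of c b] that by auto
    then show False using c(1) \<open>c q = 0\<close> by auto
  qed
  have cb: "c b = 0" if b: "b \<in> T - B" for b
  proof -
    obtain d where d: "\<exists>i\<in>insert q (T - {b}). d i \<noteq> 0"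
      "\<forall>k\<in>{1..n}. (\<Sum>i\<in>insert q (T - {b}). d i * \<gamma> (k, i)) = 0"
      using exchange[OF b] unfolding lin_dep_family_def by blast
    let ?d = "d(b := 0)"
    have sum_d: "(\<Sum>i\<in>T - {b}. d i * \<gamma> (k, i)) = (\<Sum>i\<in>T. ?d i * \<gamma> (k, i))" for k
      using T by (intro sum.mono_neutral_cong_left) auto
    have d_rel: "d q * \<gamma> (k, q) + (\<Sum>i\<in>T. ?d i * \<gamma> (k, i)) = 0" if "k \<in> {1..n}" for k
      unfolding sum_d[symmetric] using d(2) that T q by simp
    have dq: "d q \<noteq> 0"
    proof
      assume dq: "d q = 0"
      then have "?d i = 0" if "i \<in> T" for i using d_rel zero[of ?d i] that by auto
      then have "d i = 0" if "i \<in> T - {b}" for i using that by (metis DiffD1 DiffD2 fun_upd_other singletonI)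
      then show False using d(1) dq by auto
    qed
    \<comment> \<open>Eliminating \<open>q\<close> from the two relations leaves one on the
      independent \<open>T\<close>, hence a trivial one. At \<open>b\<close> the second relation has
      coefficient \<open>0\<close>, which forces \<open>c b = 0\<close>.\<close>
    have "(\<Sum>i\<in>T. (d q * c i - c q * ?d i) * \<gamma> (k, i)) = 0" if "k \<in> {1..n}" for k
    proof -
      have "(\<Sum>i\<in>T. (d q * c i - c q * ?d i) * \<gamma> (k, i))
          = d q * (\<Sum>i\<in>T. c i * \<gamma> (k, i)) - c q * (\<Sum>i\<in>T. ?d i * \<gamma> (k, i))"
        by (simp only: sum_distrib_left left_diff_distrib sum_subtractf mult.assoc)
      also have "\<dots> = d q * (- c q * \<gamma> (k, q)) - c q * (- d q * \<gamma> (k, q))"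
        using c_rel[OF that] d_rel[OF that] by (simp add: add_eq_0_iff)
      finally show ?thesis by simp
    qed
    then have "d q * c b - c q * ?d b = 0" using zero[of "\<lambda>i. d q * c i - c q * ?d i" b] b by auto
    then show ?thesis using dq by simp
  qed
  show ?thesis
  proof (rule that[of "\<lambda>b. - c b / c q"])
    fix k assume k: "k \<in> {1..n}"
    have "(\<Sum>i\<in>T. c i * \<gamma> (k, i)) = (\<Sum>i\<in>B. c i * \<gamma> (k, i))"
      using T B cb by (intro sum.mono_neutral_right) auto
    then have "\<gamma> (k, q) = - (\<Sum>i\<in>B. c i * \<gamma> (k, i)) / c q"
      using c_rel[OF k] cq by (simp add: field_simps eq_neg_iff_add_eq_0)
    then show "\<gamma> (k, q) = (\<Sum>b\<in>B. - c b / c q * \<gamma> (k, b))"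
      by (simp add: sum_divide_distrib sum_negf)
  qed
qed

text \<open>The Leibniz formula makes the determinant of the square matrix with columns
  \<open>T\<close> a polynomial function of its entries.\<close>

lemma lin_dep_family_determinant:
  assumes "finite T" "card T = n" "T \<subseteq> E"
  obtains D where "D \<in> poly_functions ({1..n} \<times> E)" "\<And>\<gamma>. D \<gamma> = 0 \<longleftrightarrow> lin_dep_family n \<gamma> T"
proof -
  obtain b where b: "bij_betw b {0..<n} T" using ex_bij_betw_nat_finite[OF assms(1)] assms(2) by blast
  \<comment> \<open>Matrix rows start at \<open>0\<close>, coordinates at \<open>1\<close>, hence
    the \<open>Suc\<close>.\<close>
  define A where "A \<gamma> = mat n n (\<lambda>(i, j). \<gamma> (Suc i, b j) :: complex)" for \<gamma>
  have A: "A \<gamma> \<in> carrier_mat n n" for \<gamma> by (simp add: A_def)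
  let ?P = "{\<pi>. \<pi> permutes {0..<n}}"
  have bE: "b j \<in> E" if "j < n" for j using bij_betwE[OF b] that assms(3) by auto
  have "(\<Sum>\<pi>\<in>?P. (\<lambda>\<gamma>. signof \<pi>) * (\<Prod>i = 0..<n. (\<lambda>\<gamma>. \<gamma> (Suc i, b (\<pi> i))))) \<in> poly_functions ({1..n} \<times> E)"
  proof (intro poly_functions_intros)
    fix \<pi> i assume "\<pi> \<in> ?P" "i \<in> {0..<n}"
    then have "\<pi> i < n" using permutes_in_image[of \<pi> "{0..<n}" i] by auto
    then show "(Suc i, b (\<pi> i)) \<in> {1..n} \<times> E" using bE \<open>i \<in> {0..<n}\<close> by auto
  qed
  moreover have "(\<Sum>\<pi>\<in>?P. (\<lambda>\<gamma>. signof \<pi>) * (\<Prod>i = 0..<n. (\<lambda>\<gamma>. \<gamma> (Suc i, b (\<pi> i))))) = (\<lambda>\<gamma>. det (A \<gamma>))"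
  proof
    fix \<gamma>
    have "(\<Prod>i = 0..<n. \<gamma> (Suc i, b (\<pi> i))) = (\<Prod>i = 0..<n. A \<gamma> $$ (i, \<pi> i))" if "\<pi> \<in> ?P" for \<pi>
      using that permutes_in_image[of \<pi> "{0..<n}"] by (intro prod.cong) (auto simp: A_def)
    then show "(\<Sum>\<pi>\<in>?P. (\<lambda>\<gamma>. signof \<pi>) * (\<Prod>i = 0..<n. (\<lambda>\<gamma>. \<gamma> (Suc i, b (\<pi> i))))) \<gamma> = det (A \<gamma>)"
      unfolding det_def'[OF A] by (simp add: sum_fun_apply prod_fun_apply)
  qed
  moreover have "det (A \<gamma>) = 0 \<longleftrightarrow> lin_dep_family n \<gamma> T" for \<gamma>
  proof -
    have prod_eq: "(A \<gamma> *\<^sub>v v) $ i = (\<Sum>j = 0..<n. v $ j * \<gamma> (Suc i, b j))"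
      if "v \<in> carrier_vec n" "i < n" for v i
      using that by (auto simp: A_def scalar_prod_def mult.commute intro!: sum.cong)
    have reindex: "(\<Sum>j = 0..<n. c (b j) * \<gamma> (k, b j)) = (\<Sum>i\<in>T. c i * \<gamma> (k, i))" for c k
      by (rule sum.reindex_bij_betw[OF b])
    have "lin_dep_family n \<gamma> T" if det: "det (A \<gamma>) = 0"
    proof -
      obtain v where v: "v \<in> carrier_vec n" "v \<noteq> 0\<^sub>v n" "A \<gamma> *\<^sub>v v = 0\<^sub>v n"
        using det det_0_iff_vec_prod_zero_field[OF A[of \<gamma>]] by blast
      let ?c = "\<lambda>i. v $ inv_into {0..<n} b i"
      have cb: "?c (b j) = v $ j" if "j < n" for j
        using bij_betw_inv_into_left[OF b, of j] that by simp
      obtain j where j: "j < n" "v $ j \<noteq> 0" using v(1,2) by (metis carrier_vecD eq_vecI index_zero_vec)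
      then have "b j \<in> T" "?c (b j) \<noteq> 0" using bij_betwE[OF b] cb by auto
      moreover have "(\<Sum>i\<in>T. ?c i * \<gamma> (k, i)) = 0" if k: "k \<in> {1..n}" for k
      proof -
        obtain i where i: "k = Suc i" "i < n" using k by (cases k) auto
        have "(\<Sum>i\<in>T. ?c i * \<gamma> (k, i)) = (\<Sum>j = 0..<n. v $ j * \<gamma> (Suc i, b j))"
          unfolding reindex[symmetric] using cb i by (intro sum.cong) auto
        also have "\<dots> = 0" using prod_eq[OF v(1) i(2)] v(3) i by simp
        finally show ?thesis .
      qed
      ultimately show ?thesis unfolding lin_dep_family_def by (intro exI[of _ ?c] conjI bexI[of _ "b j"] ballI)
    qed
    moreover have "det (A \<gamma>) = 0" if "lin_dep_family n \<gamma> T"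
    proof -
      obtain c where c: "\<exists>i\<in>T. c i \<noteq> 0" "\<forall>k\<in>{1..n}. (\<Sum>i\<in>T. c i * \<gamma> (k, i)) = 0"
        using \<open>lin_dep_family n \<gamma> T\<close> unfolding lin_dep_family_def by blast
      let ?v = "vec n (\<lambda>j. c (b j))"
      obtain i where "i \<in> T" "c i \<noteq> 0" using c(1) by blast
      then obtain j where "j < n" "c (b j) \<noteq> 0" using b by (auto simp: bij_betw_def)
      then have "?v \<noteq> 0\<^sub>v n" by (metis index_vec index_zero_vec(1))
      moreover have "A \<gamma> *\<^sub>v ?v = 0\<^sub>v n"
      proof (rule eq_vecI)
        fix i assume "i < dim_vec (0\<^sub>v n :: complex vec)"
        then have i: "i < n" by simp
        have "(A \<gamma> *\<^sub>v ?v) $ i = (\<Sum>i'\<in>T. c i' * \<gamma> (Suc i, i'))"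
          unfolding reindex[symmetric] using i by (subst prod_eq) (auto intro!: sum.cong)
        then show "(A \<gamma> *\<^sub>v ?v) $ i = 0\<^sub>v n $ i" using c(2) i by simp
      qed (simp add: A_def)
      ultimately show ?thesis
        unfolding det_0_iff_vec_prod_zero_field[OF A[of \<gamma>]] by (intro exI[of _ ?v] conjI vec_carrier)
    qed
    ultimately show ?thesis by blast
  qed
  ultimately show ?thesis by (intro that[of "\<lambda>\<gamma>. det (A \<gamma>)"]) simp_all
qed

section \<open>Matroids\<close>

context matroid
begin

lemma indep_finite: "indep X \<Longrightarrow> finite X"
  using indep_subset_ground finite_ground finite_subset by blast

lemma indep_cards_finite_nonempty:
  assumes "finite X"
  shows "finite {card Y | Y. Y \<subseteq> X \<and> indep Y}" "{card Y | Y. Y \<subseteq> X \<and> indep Y} \<noteq> {}"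
proof -
  have "{card Y | Y. Y \<subseteq> X \<and> indep Y} \<subseteq> card ` Pow X" by auto
  then show "finite {card Y | Y. Y \<subseteq> X \<and> indep Y}" using assms by (auto intro: finite_subset)
  show "{card Y | Y. Y \<subseteq> X \<and> indep Y} \<noteq> {}" using indep_empty by auto
qed

lemma card_le_rank_of: "finite X \<Longrightarrow> Y \<subseteq> X \<Longrightarrow> indep Y \<Longrightarrow> card Y \<le> rank_of X"
  unfolding rank_of_def by (intro Max_ge indep_cards_finite_nonempty) auto

lemma rank_of_witness:
  assumes "finite X"
  obtains Y where "Y \<subseteq> X" "indep Y" "card Y = rank_of X"
  using Max_in[OF indep_cards_finite_nonempty[OF assms]] unfolding rank_of_def by auto

lemma extend_to_basis:
  assumes "finite X" "Y \<subseteq> X" "indep Y"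
  obtains Z where "Y \<subseteq> Z" "Z \<subseteq> X" "indep Z" "card Z = rank_of X"
proof -
  obtain W where W: "W \<subseteq> X" "indep W" "card W = rank_of X" using rank_of_witness[OF assms(1)] .
  have "\<exists>Z. Y \<subseteq> Z \<and> Z \<subseteq> X \<and> indep Z \<and> card Z = rank_of X"
    using assms(2,3)
  proof (induction "rank_of X - card Y" arbitrary: Y)
    case 0
    then show ?case using card_le_rank_of[OF assms(1), of Y] by (intro exI[of _ Y]) auto
  next
    case (Suc d)
    then have "card Y < card W" using W by simp
    then obtain y where y: "y \<in> W - Y" "indep (insert y Y)" using indep_augment Suc.prems W by blast
    have "d = rank_of X - card (insert y Y)" using Suc y indep_finite[of Y] by simp
    from Suc.hyps(1)[OF this] y W Suc.prems show ?case by auto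
  qed
  then show ?thesis using that by blast
qed

lemma subset_cl: "X \<subseteq> E \<Longrightarrow> X \<subseteq> cl X"
  by (auto simp: cl_def insert_absorb)

text \<open>\<open>cl\<close> controls only the insertion of a single element. A larger independent
  set would augment a maximal independent subset of \<open>X\<close> by one element of
  \<open>cl X\<close>, which already raises the rank.\<close>

lemma card_indep_in_cl:
  assumes "X \<subseteq> E" "Y \<subseteq> cl X" "indep Y"
  shows "card Y \<le> rank_of X"
proof (rule ccontr)
  have fin: "finite X" using assms finite_ground finite_subset by blast
  obtain Z where Z: "Z \<subseteq> X" "indep Z" "card Z = rank_of X" using rank_of_witness[OF fin] .
  assume "\<not> card Y \<le> rank_of X"
  then obtain y where y: "y \<in> Y - Z" "indep (insert y Z)"
    using indep_augment[OF Z(2) assms(3)] Z by auto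
  have "card (insert y Z) \<le> rank_of (insert y X)" using fin Z y by (intro card_le_rank_of) auto
  moreover have "rank_of (insert y X) = rank_of X" using y assms(2) by (auto simp: cl_def)
  ultimately show False using Z y indep_finite[OF Z(2)] by simp
qed

lemma rank_of_le_of_subset_cl:
  assumes "X \<subseteq> E" "Y \<subseteq> cl X"
  shows "rank_of Y \<le> rank_of X"
proof -
  have "cl X \<subseteq> E" by (auto simp: cl_def)
  then have "finite Y" using assms(2) finite_subset[OF _ finite_ground] by blast
  then obtain Z where "Z \<subseteq> Y" "indep Z" "card Z = rank_of Y" by (rule rank_of_witness)
  then show ?thesis using card_indep_in_cl[OF assms(1), of Z] assms(2) by auto
qed

lemma dependent_contains_circuit:
  assumes "dependent S"
  obtains C where "circuit C" "C \<subseteq> S"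
proof -
  have "finite S" using assms finite_ground finite_subset unfolding dependent_def by blast
  then have "dependent S \<longrightarrow> (\<exists>C. circuit C \<and> C \<subseteq> S)"
  proof (induction S rule: finite_psubset_induct)
    case (psubset S)
    show ?case
    proof
      assume "dependent S"
      show "\<exists>C. circuit C \<and> C \<subseteq> S"
      proof (cases "circuit S")
        case False
        then obtain D where D: "D \<subset> S" "dependent D" using \<open>dependent S\<close> unfolding circuit_def by blast
        obtain C where "circuit C" "C \<subseteq> D" using psubset.IH[OF D(1)] D(2) by blast
        then show ?thesis using D(1) by blast
      qed blast
    qed
  qed
  then show ?thesis using assms that by blast
qed

lemma card_circuit:
  assumes "circuit C"
  shows "card C = Suc (rank_of C)"
proof -
  have C: "C \<subseteq> E" "\<not> indep C" using assms by (auto simp: circuit_def dependent_def)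
  then have fin: "finite C" using finite_ground finite_subset by blast
  have "C \<noteq> {}" using C indep_empty by metis
  then obtain x where x: "x \<in> C" by blast
  have "indep (C - {x})" using assms x C unfolding circuit_def dependent_def by blast
  then have "card (C - {x}) \<le> rank_of C" using fin by (intro card_le_rank_of) auto
  moreover obtain Y where Y: "Y \<subseteq> C" "indep Y" "card Y = rank_of C" using rank_of_witness[OF fin] .
  then have "Y \<subset> C" using C by blast
  then have "card Y < card C" using fin psubset_card_mono by blast
  ultimately show ?thesis using Y x fin by (simp add: card_Diff_singleton)
qed

text \<open>A maximal independent subset \<open>B\<close> of one circuit suffices for the whole
  class: equivalent circuits have the same closure, so all points lie in it and all ranks agree.
  Every circuit of the class then has one element more than \<open>B\<close>.\<close>

lemma subspace_basis:
  assumes "l \<in> subspaces"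
  obtains B T where "B \<subseteq> T" "indep T" "card T = rank_of E" "B \<subseteq> subspace_points l"
    "card B = subspace_rank l" "subspace_points l \<subseteq> E"
    "\<And>q. q \<in> subspace_points l - B \<Longrightarrow> \<not> indep (insert q B)"
    "\<And>C. C \<in> l \<Longrightarrow> card C = Suc (card B)"
proof -
  obtain C where C: "C \<in> small_circuits" "l = circuit_equiv `` {C}"
    using assms unfolding subspaces_def by (auto elim: quotientE)
  have l: "D \<in> l \<longleftrightarrow> D \<in> small_circuits \<and> cl D = cl C" for D
    using C by (auto simp: circuit_equiv_def)
  have sub: "D \<subseteq> E" "circuit D" if "D \<in> small_circuits" for D
    using that by (auto simp: small_circuits_def circuit_def dependent_def)
  have points_cl: "subspace_points l \<subseteq> cl C"
  proof
    fix x assume "x \<in> subspace_points l"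
    then obtain D where "D \<in> l" "x \<in> D" unfolding subspace_points_def by blast
    then show "x \<in> cl C" using l[of D] subset_cl[OF sub(1), of D] by auto
  qed
  have rank: "rank_of D = rank_of C" if "D \<in> l" for D
  proof (rule order_antisym)
    have D: "D \<subseteq> E" "C \<subseteq> E" "cl D = cl C" using that l sub C by auto
    then show "rank_of D \<le> rank_of C" "rank_of C \<le> rank_of D"
      using rank_of_le_of_subset_cl[of C D] rank_of_le_of_subset_cl[of D C] subset_cl[of C] subset_cl[of D]
      by auto
  qed
  have Cl: "C \<in> l" using l C(1) by simp
  have "rank_of ` l = {rank_of C}"
  proof (intro equalityI subsetI)
    show "x \<in> {rank_of C}" if "x \<in> rank_of ` l" for x using that rank by blast
    show "x \<in> rank_of ` l" if "x \<in> {rank_of C}" for x using that Cl by blast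
  qed
  then have srank: "subspace_rank l = rank_of C" by (simp add: subspace_rank_def)
  have CE: "C \<subseteq> E" using sub(1)[OF C(1)] .
  then have "finite C" using finite_subset finite_ground by blast
  then obtain B where B: "B \<subseteq> C" "indep B" "card B = rank_of C" using rank_of_witness by blast
  obtain T where T: "B \<subseteq> T" "T \<subseteq> E" "indep T" "card T = rank_of E"
    using extend_to_basis[OF finite_ground _ B(2)] B CE by blast
  show ?thesis
  proof (rule that[of B T])
    show "B \<subseteq> subspace_points l" using B(1) Cl unfolding subspace_points_def by blast
    show "subspace_points l \<subseteq> E" using points_cl by (auto simp: cl_def)
    show "\<not> indep (insert q B)" if "q \<in> subspace_points l - B" for q
    proof
      assume "indep (insert q B)"
      moreover have "insert q B \<subseteq> cl C" using that points_cl B subset_cl[OF CE] by blast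
      ultimately have "card (insert q B) \<le> rank_of C" using card_indep_in_cl[OF CE] by blast
      then show False using that B indep_finite[OF B(2)] by simp
    qed
    show "card D = Suc (card B)" if "D \<in> l" for D
      using card_circuit[of D] rank[OF that] sub[of D] l that B by simp
  qed (use T B srank in auto)
qed

lemma finite_subspaces: "finite subspaces"
proof -
  have "subspaces \<subseteq> Pow (Pow E)"
  proof
    fix l assume "l \<in> subspaces"
    then have "subspace_points l \<subseteq> E" using subspace_basis[of l] by metis
    then show "l \<in> Pow (Pow E)" by (auto simp: subspace_points_def)
  qed
  then show ?thesis using finite_ground finite_subset by blast
qed

end

section \<open>Realization spaces\<close>

context matroid
begin

text \<open>A dependent set contains a circuit. A large one is dependent for lack of room, a small
  one because its points lie in the span of the smaller set \<open>B l\<close>. Conversely an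
  independent set extends to a basis, which is independent by assumption.\<close>

lemma in_realization_spaceI:
  assumes x: "x \<in> affine_space ({1..rank_of E} \<times> E)"
    and bases: "\<And>T. indep T \<Longrightarrow> card T = rank_of E \<Longrightarrow> \<not> lin_dep_family (rank_of E) x T"
    and BT: "\<And>l. l \<in> subspaces \<Longrightarrow> B l \<subseteq> T l" "\<And>l. l \<in> subspaces \<Longrightarrow> indep (T l)"
      "\<And>l. l \<in> subspaces \<Longrightarrow> card (T l) = rank_of E"
      "\<And>l q. l \<in> subspaces \<Longrightarrow> q \<in> subspace_points l - B l \<Longrightarrow> q \<notin> T l"
      "\<And>l C. l \<in> subspaces \<Longrightarrow> C \<in> l \<Longrightarrow> card C = Suc (card (B l))"
    and exchange: "\<And>l q b. l \<in> subspaces \<Longrightarrow> q \<in> subspace_points l - B l \<Longrightarrow> b \<in> T l - B l \<Longrightarrow>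
      lin_dep_family (rank_of E) x (insert q (T l - {b}))"
  shows "x \<in> realization_space"
proof -
  let ?n = "rank_of E"
  have in_span: "\<exists>a. \<forall>k\<in>{1..?n}. x (k, q) = (\<Sum>b\<in>B l. a b * x (k, b))"
    if l: "l \<in> subspaces" and q: "q \<in> subspace_points l" for l q
  proof (cases "q \<in> B l")
    case True
    have fin: "finite (B l)" using BT(1,2)[OF l] indep_finite finite_subset by blast
    have "(\<Sum>b\<in>B l. (if b = q then 1 else 0) * x (k, b)) = x (k, q)" for k
    proof -
      have "(\<Sum>b\<in>B l. (if b = q then 1 else 0) * x (k, b)) = (\<Sum>b\<in>B l. if b = q then x (k, b) else 0)"
        by (intro sum.cong) auto
      then show ?thesis using True fin by simp
    qed
    then show ?thesis by (intro exI[of _ "\<lambda>b. if b = q then 1 else 0"]) simp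
  next
    case False
    then have q': "q \<in> subspace_points l - B l" using q by blast
    obtain a where "\<And>k. k \<in> {1..?n} \<Longrightarrow> x (k, q) = (\<Sum>b\<in>B l. a b * x (k, b))"
    proof (rule in_span_of_exchange[of "T l" ?n x "B l" q])
      show "lin_dep_family ?n x (insert q (T l - {b}))" if "b \<in> T l - B l" for b
        using exchange[OF l q' that] .
    qed (use BT[OF l] bases[OF BT(2,3)[OF l]] indep_finite[OF BT(2)[OF l]] q' in auto)
    then show ?thesis by blast
  qed
  have "lin_dep_family ?n x S" if "dependent S" for S
  proof -
    obtain C where C: "circuit C" "C \<subseteq> S" using dependent_contains_circuit[OF \<open>dependent S\<close>] .
    have finS: "finite S" using \<open>dependent S\<close> finite_subset[OF _ finite_ground] by (auto simp: dependent_def)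
    then have finC: "finite C" using C finite_subset by blast
    have "lin_dep_family ?n x C"
    proof (cases "card C \<le> ?n")
      case True
      then have small: "C \<in> small_circuits" using C by (simp add: small_circuits_def)
      define l where "l = circuit_equiv `` {C}"
      have l: "l \<in> subspaces" unfolding l_def subspaces_def using small by (rule quotientI)
      have Cl: "C \<in> l" unfolding l_def circuit_equiv_def using small by simp
      then have "C \<subseteq> subspace_points l" unfolding subspace_points_def by blast
      then have "\<forall>q. \<exists>a. q \<in> C \<longrightarrow> (\<forall>k\<in>{1..?n}. x (k, q) = (\<Sum>b\<in>B l. a b * x (k, b)))"
        using in_span[OF l] by blast
      from choice[OF this] obtain a where
        a: "\<forall>q. q \<in> C \<longrightarrow> (\<forall>k\<in>{1..?n}. x (k, q) = (\<Sum>b\<in>B l. a q b * x (k, b)))" by blast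
      show ?thesis
      proof (rule lin_dep_family_in_span[of "B l" _ _ _ a "\<lambda>k b. x (k, b)"])
        show "finite (B l)" using finite_subset[OF BT(1)[OF l] indep_finite[OF BT(2)[OF l]]] .
        show "card (B l) < card C" using BT(5)[OF l Cl] by simp
      qed (use finC a in auto)
    next
      case False
      then show ?thesis using finC by (intro lin_dep_family_card) auto
    qed
    then show ?thesis using lin_dep_family_mono C(2) finS by blast
  qed
  moreover have "dependent S" if S: "S \<subseteq> E" "lin_dep_family ?n x S" for S
  proof (rule ccontr)
    assume "\<not> dependent S"
    then have "indep S" using S by (simp add: dependent_def)
    obtain T where T: "S \<subseteq> T" "T \<subseteq> E" "indep T" "card T = ?n"
      by (rule extend_to_basis[OF finite_ground S(1) \<open>indep S\<close>])
    then have "lin_dep_family ?n x T" using lin_dep_family_mono[OF S(2)] indep_finite by blast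
    then show False using bases T by blast
  qed
  ultimately show ?thesis using x unfolding realization_space_def by blast
qed

theorem naive_dimension_le:
  assumes "realizable"
  shows "ereal (real (rank_of E) * real (card E) -
      (\<Sum>l\<in>subspaces. (real (card (subspace_points l)) - real (subspace_rank l)) *
        (real (rank_of E) - real (subspace_rank l))))
    \<le> zariski_dim ({1..rank_of E} \<times> E) realization_space"
proof -
  let ?n = "rank_of E" and ?I = "{1..rank_of E} \<times> E"
  have finI: "finite ?I" using finite_ground by simp
  obtain p where p: "p \<in> realization_space" using assms unfolding realizable_def by blast
  then have p_dep: "lin_dep_family ?n p S \<longleftrightarrow> dependent S" if "S \<subseteq> E" for S
    using that unfolding realization_space_def by blast
  have "\<forall>l. \<exists>BT. l \<in> subspaces \<longrightarrow> fst BT \<subseteq> snd BT \<and> indep (snd BT) \<and> card (snd BT) = ?n \<and>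
      fst BT \<subseteq> subspace_points l \<and> card (fst BT) = subspace_rank l \<and> subspace_points l \<subseteq> E \<and>
      (\<forall>q \<in> subspace_points l - fst BT. \<not> indep (insert q (fst BT))) \<and>
      (\<forall>C\<in>l. card C = Suc (card (fst BT)))" (is "\<forall>l. \<exists>BT. _ \<longrightarrow> ?Q l BT")
  proof (intro allI)
    fix l
    show "\<exists>BT. l \<in> subspaces \<longrightarrow> ?Q l BT"
    proof (cases "l \<in> subspaces")
      case True
      show ?thesis
      proof (rule subspace_basis[OF True])
        fix B T
        assume *: "B \<subseteq> T" "indep T" "card T = ?n" "B \<subseteq> subspace_points l" "card B = subspace_rank l"
          "subspace_points l \<subseteq> E" "\<And>q. q \<in> subspace_points l - B \<Longrightarrow> \<not> indep (insert q B)"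
          "\<And>C. C \<in> l \<Longrightarrow> card C = Suc (card B)"
        show ?thesis
          unfolding fst_conv snd_conv by (intro exI[of _ "(B, T)"] impI conjI ballI) (simp_all add: *)
      qed
    qed simp
  qed
  from choice[OF this] obtain BT where BT': "\<forall>l. l \<in> subspaces \<longrightarrow> ?Q l (BT l)" ..
  define B where "B l = fst (BT l)" for l
  define T where "T l = snd (BT l)" for l
  have BT: "B l \<subseteq> T l" "indep (T l)" "card (T l) = ?n" "B l \<subseteq> subspace_points l"
    "card (B l) = subspace_rank l" "subspace_points l \<subseteq> E"
    "\<And>q. q \<in> subspace_points l - B l \<Longrightarrow> \<not> indep (insert q (B l))"
    "\<And>C. C \<in> l \<Longrightarrow> card C = Suc (card (B l))"
    if "l \<in> subspaces" for l
    using BT'[rule_format, OF that] unfolding B_def T_def by blast+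
  have q_notin: "q \<notin> T l" if "l \<in> subspaces" "q \<in> subspace_points l - B l" for l q
  proof
    assume "q \<in> T l"
    then have "indep (insert q (B l))" using indep_subset[OF BT(2)[OF that(1)]] BT(1)[OF that(1)] by blast
    then show False using BT(7)[OF that] by blast
  qed
  define D where "D S = (SOME D. D \<in> poly_functions ?I \<and> (\<forall>\<gamma>. D \<gamma> = 0 \<longleftrightarrow> lin_dep_family ?n \<gamma> S))" for S
  have D: "D S \<in> poly_functions ?I" "D S \<gamma> = 0 \<longleftrightarrow> lin_dep_family ?n \<gamma> S"
    if S: "S \<subseteq> E" "card S = ?n" for S \<gamma>
  proof -
    have "\<exists>D. D \<in> poly_functions ?I \<and> (\<forall>\<gamma>. D \<gamma> = 0 \<longleftrightarrow> lin_dep_family ?n \<gamma> S)"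
      using lin_dep_family_determinant[OF finite_subset[OF S(1) finite_ground] S(2,1)] by metis
    from someI_ex[OF this] show "D S \<in> poly_functions ?I" "D S \<gamma> = 0 \<longleftrightarrow> lin_dep_family ?n \<gamma> S"
      unfolding D_def by blast+
  qed
  \<comment> \<open>The index set of the equations. Different triples may give the same determinant,
    so \<open>F\<close> has at most \<open>card Q\<close> elements, which is the direction
    needed.\<close>
  define Q where "Q = (SIGMA l:subspaces. (subspace_points l - B l) \<times> (T l - B l))"
  define F where "F = (\<lambda>(l, q, b). D (insert q (T l - {b}))) ` Q"
  define bases where "bases = {T. indep T \<and> card T = ?n}"
  \<comment> \<open>Nonzero exactly where every basis of the matroid stays independent, in
    particular at \<open>p\<close>.\<close>
  define g where "g = (\<Prod>T\<in>bases. D T)"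
  \<comment> \<open>As \<open>b\<close> is not in \<open>B l\<close>, the exchanged set still
    contains the dependent set \<open>insert q (B l)\<close>. Therefore all equations hold at
    \<open>p\<close>.\<close>
  have exch: "insert q (T l - {b}) \<subseteq> E" "card (insert q (T l - {b})) = ?n" "dependent (insert q (T l - {b}))"
    if l: "l \<in> subspaces" and q: "q \<in> subspace_points l - B l" and b: "b \<in> T l - B l" for l q b
  proof -
    show sub: "insert q (T l - {b}) \<subseteq> E"
      using q BT(6)[OF l] indep_subset_ground[OF BT(2)[OF l]] by blast
    have "card (insert q (T l - {b})) = Suc (card (T l - {b}))"
      using q_notin[OF l q] indep_finite[OF BT(2)[OF l]] by simp
    also have "\<dots> = card (T l)"
      using b indep_finite[OF BT(2)[OF l]] by (intro card_Suc_Diff1) auto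
    finally show "card (insert q (T l - {b})) = ?n" using BT(3)[OF l] by simp
    have "insert q (B l) \<subseteq> insert q (T l - {b})" using b BT(1)[OF l] by blast
    then have "\<not> indep (insert q (T l - {b}))" using BT(7)[OF l q] indep_subset by blast
    then show "dependent (insert q (T l - {b}))" using sub by (simp add: dependent_def)
  qed
  have finpts: "finite (subspace_points l)" "finite (B l)" "finite (T l)" if "l \<in> subspaces" for l
    using finite_subset[OF BT(6)[OF that] finite_ground] finite_subset[OF BT(4)[OF that]]
      indep_finite[OF BT(2)[OF that]] by blast+
  have finQ: "finite Q" unfolding Q_def using finite_subspaces finpts by (intro finite_SigmaI) auto
  have bases: "T \<subseteq> E" "card T = ?n" "indep T" if "T \<in> bases" for T
    using that indep_subset_ground by (auto simp: bases_def)
  then have finbases: "finite bases" using finite_subset[of bases "Pow E"] finite_ground by blast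
  have F: "F \<subseteq> poly_functions ?I" unfolding F_def Q_def using D(1) exch by auto
  have g: "g \<in> poly_functions ?I" unfolding g_def using D(1) bases by (intro poly_functions_intros) auto
  have gx: "g x \<noteq> 0 \<longleftrightarrow> (\<forall>T\<in>bases. \<not> lin_dep_family ?n x T)" for x
    unfolding g_def prod_fun_apply using finbases D(2) bases by (simp add: prod_zero_iff)
  have gp: "g p \<noteq> 0" unfolding gx using p_dep bases by (auto simp: dependent_def)
  have pF: "p \<in> zero_set ?I F"
    using p D(2) exch p_dep unfolding zero_set_def F_def Q_def realization_space_def by auto
  have "x \<in> realization_space" if x: "x \<in> zero_set ?I F" "g x \<noteq> 0" for x
  proof (rule in_realization_spaceI[of x B T])
    show "x \<in> affine_space ?I" using x by (simp add: zero_set_def)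
    show "\<not> lin_dep_family ?n x T" if "indep T" "card T = ?n" for T
      using x(2) that unfolding gx bases_def by blast
    show "lin_dep_family ?n x (insert q (T l - {b}))"
      if l: "l \<in> subspaces" "q \<in> subspace_points l - B l" "b \<in> T l - B l" for l q b
    proof -
      have "(l, q, b) \<in> Q" using l unfolding Q_def by blast
      then have "D (insert q (T l - {b})) \<in> F" unfolding F_def by (force intro: image_eqI)
      then have "D (insert q (T l - {b})) x = 0" using x(1) by (simp add: zero_set_def)
      then show ?thesis using D(2)[OF exch(1,2)[OF l]] by blast
    qed
  qed (use BT q_notin in auto)
  moreover have "realization_space \<subseteq> affine_space ?I" by (auto simp: realization_space_def)
  moreover have "card Q = (\<Sum>l\<in>subspaces. (card (subspace_points l) - card (B l)) * (?n - card (B l)))"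
  proof -
    have "card Q = (\<Sum>l\<in>subspaces. card ((subspace_points l - B l) \<times> (T l - B l)))"
      unfolding Q_def using finite_subspaces finpts by (intro card_SigmaI) auto
    also have "\<dots> = (\<Sum>l\<in>subspaces. (card (subspace_points l) - card (B l)) * (?n - card (B l)))"
    proof (intro sum.cong refl)
      fix l assume l: "l \<in> subspaces"
      show "card ((subspace_points l - B l) \<times> (T l - B l)) =
          (card (subspace_points l) - card (B l)) * (?n - card (B l))"
        unfolding card_cartesian_product
        using card_Diff_subset[OF finpts(2)[OF l] BT(4)[OF l]] card_Diff_subset[OF finpts(2)[OF l] BT(1)[OF l]]
          BT(3)[OF l] by simp
    qed
    finally show ?thesis .
  qed
  then have cardQ: "real (card Q) = (\<Sum>l\<in>subspaces. (real (card (subspace_points l)) - real (subspace_rank l)) *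
        (real ?n - real (subspace_rank l)))"
    unfolding of_nat_sum
  proof (simp only: of_nat_sum, intro sum.cong refl)
    fix l assume l: "l \<in> subspaces"
    \<comment> \<open>These bounds make the natural subtractions in the count agree with the real
      ones in the naive dimension.\<close>
    have "card (B l) \<le> card (subspace_points l)" "card (B l) \<le> ?n"
      using card_mono[OF finpts(1)[OF l] BT(4)[OF l]] card_mono[OF finpts(3)[OF l] BT(1)[OF l]] BT(3)[OF l] by auto
    then show "real ((card (subspace_points l) - card (B l)) * (?n - card (B l))) =
        (real (card (subspace_points l)) - real (subspace_rank l)) * (real ?n - real (subspace_rank l))"
      using BT(5)[OF l] by (simp add: of_nat_diff)
  qed
  \<comment> \<open>Truncated subtraction is at least the real difference, so a negative naive
    dimension does no harm.\<close>
  let ?k = "card ?I - card Q"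
  have "card F \<le> card Q" unfolding F_def by (rule card_image_le[OF finQ])
  then have "chain_through ?I p (zero_set ?I F) ?k"
    using finI finQ F pF by (intro chain_through_zero_set) (auto simp: F_def)
  ultimately have "ereal (real ?k) \<le> zariski_dim ?I realization_space"
    using zariski_dim_ge_chain_length[OF _ g gp] p by blast
  moreover have "real ?n * real (card E) - real (card Q) \<le> real ?k"
  proof -
    have "real (card ?I) - real (card Q) \<le> real ?k" by linarith
    then show ?thesis by (simp add: card_cartesian_product)
  qed
  ultimately show ?thesis unfolding cardQ[symmetric] using order_trans ereal_less_eq(3) by blast
qed

end

theorem theorem3p3:
  fixes n d :: nat and indep :: "nat set \<Rightarrow> bool"
  assumes "matroid {1..d} indep"
    and "matroid.rank_of indep {1..d} = n"
    and "matroid.realizable {1..d} indep"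
  shows "ereal (real n * real d -
      (\<Sum>l\<in>matroid.subspaces {1..d} indep.
        (real (card (matroid.subspace_points l)) - real (matroid.subspace_rank indep l)) *
        (real n - real (matroid.subspace_rank indep l))))
    \<le> zariski_dim ({1..n} \<times> {1..d}) (matroid.realization_space {1..d} indep)"
  using matroid.naive_dimension_le[OF assms(1,3)] unfolding assms(2) by simp

end
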